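(* Consider the closed-loop switched system with switching rule $\alpha_n$, thresholds $t_N=\sqrt{(1+\rho)S\log N/N}$ ($\rho>0$), and events $E_N=\{\|\Phi^{(1)}_N\|>t_N\}\cup\{\|\Phi^{(2)}_N\|>t_N\}$ described in the context, and suppose the attacker adds a perturbation $v_n$ (deterministic and/or stochastic) to the measurements. Let $$V_n=C\sum_{k=0}^{n-1}\bar L_{n,k}v_k-v_n .$$ If the attack values $v_k$ are such that there exists a positive constant $G$ with $$\frac1N\sum_{k=0}^{N-1}\|V_k\|\le\frac GN\qquad\text{for all }N\ge1,$$ then $\mathrm{P}(\limsup_{n\to\infty}E_n)=0$. That is, such a perturbation attack is detected only a finite number of times.
   Context: $\|\cdot\|$ is the spectral norm of a matrix (Euclidean norm of a vector); $\preceq$ is the semidefinite order; $\limsup_N E_N=\bigcap_{M}\bigcup_{N\ge M}E_N$. **Switched system.** $x_{n+1}=Ax_n+Bu_n+w_n$, $y_n=C(\alpha_n)x_n+z_n(\alpha_n)+\alpha_nv_n$, with $x_n\in\mathbb R^p$, $u_n\in\mathbb R^q$, $y_n\in\mathbb R^m$, $\alpha_n\in\{0,1\}$, $C(\alpha)=\alpha C_1+(1-\alpha)C_2$, $z_n(\alpha)=\alpha\zeta_n+(1-\alpha)\eta_n$. Here $w_n$ is zero-mean i.i.d. with covariance $\Sigma_w$; $\zeta_n$ and $\eta_n$ are zero-mean i.i.d. with covariances $\Sigma_\zeta\preceq\Sigma_\eta$; the process noise $(w_n)$ is independent of $(\zeta_n,\eta_n)$; almost surely $\|w_n\|\le K_w$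 and $\|\zeta_n\|,\|\eta_n\|\le K_z$ for all $n$. $(A,B)$ is stabilizable, $(A,C_1),(A,C_2)$ are detectable; $K$, $L_1$, $L_2$ are such that $A+BK$, $A+L_1C_1$, $A+L_2C_2$ are Schur stable; $L(\alpha)=\alpha L_1+(1-\alpha)L_2$. The input is $u_n=Kx'_n+e_n$, where the first observer is $x'_{n+1}=(A+BK+L(\alpha_n)C(\alpha_n))x'_n+Be_n-L(\alpha_n)y_n$, and the watermark $e_n\in\mathbb R^q$ is i.i.d. zero-mean with covariance $\Sigma_E=\Sigma_e$, $\|e_n\|\le K_e$ a.s., independent of all noises $(w_n,\zeta_n,\eta_n)$; $e_j$ is also defined (i.i.d. with the others) for the finitely many negative indices used below. **Second observer.** Write $C=C_1$, $L=L_1$, $z_n=\zeta_n$, $\Sigma_z=\Sigma_\zeta$. The second observer never switches and always uses the measurement $y_n=Cx_n+z_n+v_n$. Under attack its error $\bar\delta_n=\hat x_n-x_n$ satisfies $\bar\delta_0=0$, $\bar\delta_{n+1}=(A+LC)\bar\delta_n-w_n-Lz_n-Lv_n$. Its residual is $d_n:=C\hat x_n-y_n=C\bar\delta_n-z_n-v_n$. With $\bar D_{n,k}=-(A+LC)^{n-1-k}$, $\bar L_{n,k}=-(A+LC)^{n-1-k}L$ for $0\le k\le n-1$, and $\delta_n=\sum_{k=0}^{n-1}(\bar D_{n,k}w_k+\bar L_{n,k}z_k)$ the error without attack, one has $d_n=C\delta_n-z_n+V_n$. **Test matrices.** Let $$R_n=\mathbb E[(C\delta_n-z_n)(C\delta_n-z_n)^\top]=C\Big(\sum_{k=0}^{n-1}\bar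 D_{n,k}\Sigma_w\bar D_{n,k}^\top+\bar L_{n,k}\Sigma_z\bar L_{n,k}^\top\Big)C^\top+\Sigma_z$$ (the no-attack second moment), and $k'=\min\{k\ge0: C(A+BK)^kB\neq0\}$ (assumed to exist). Then $$\Phi^{(1)}_N=\frac1N\sum_{n=0}^{N-1}(d_nd_n^\top-R_n),\qquad \Phi^{(2)}_N=\frac1N\sum_{n=0}^{N-1}d_ne_{n-k'-1}^\top .$$ **Constant $S$.** Let $\bar K_n=K_z+\sum_{k=0}^{n-1}(\|C\bar D_{n,k}\|K_w+\|C\bar L_{n,k}\|K_z)$, and $c^{(1)}_N=8\sum_{k=0}^{N-1}\bar K_k^4$; $c^{(2)}_N=\sum_{k=0}^{N-1}\max\{(K_e^2+\mathrm{tr}\,\Sigma_E)\|R_k\|,\ \bar K_k^2(K_e^2+\|\Sigma_E\|)\}$; $c^{(3)}_N=\big\|\sum_{k=0}^{N-1}\big[(K_e^2\mathbb I-\Sigma_e)^2+\mathbb E[(e_ke_k^\top)^2]-\Sigma_e^2\big]\big\|$. $S>0$ is a constant with $\max\{c^{(1)}_N,c^{(2)}_N,c^{(3)}_N\}\le NS$ for all $N\ge1$. **Switching rule.** (i) $\alpha_N=0$ when $\|\Phi^{(1)}_N\|\ge t_N$ or $\|\Phi^{(2)}_N\|\ge t_N$; (ii) switch from $\alpha_{N-1}=0$ to $\alpha_N=1$ when $\alpha_{N-i}=0$ for all $i\in\{1,\dots,\tau\}$ and both norms are $<t_N$; otherwise $\alpha_N=\alpha_{N-1}$. Here $\mathcal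 A(\alpha)=\begin{bmatrix}A+BK&BK\\0&A+L(\alpha)C(\alpha)\end{bmatrix}$, $P$ solves $\mathcal A(1)P\mathcal A(1)^\top-P=-\mathbb I$, and $\tau$ is the smallest positive integer with $\mathcal A(0)^\tau P(\mathcal A(0)^\tau)^\top-P\preceq-\mathbb I$ (assumed to exist). *)

theory Defs
  imports "HOL-Probability.Probability"
begin

text \<open>The norm that the library puts on \<open>real^'n^'m\<close> is the Frobenius norm, and
  \<open>*\<close>, \<open>1\<close>, \<open>^\<close> and \<open>\<le>\<close> are componentwise on it; hence separate notions for the spectral norm,
  for powers with respect to the matrix product, and for the semidefinite order.\<close>

definition spectral_norm :: "real^'n^'m \<Rightarrow> real" where
  "spectral_norm A = onorm (\<lambda>x. A *v x)"

definition matpow :: "real^'n^'n \<Rightarrow> nat \<Rightarrow> real^'n^'n" where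
  "matpow A k = (((**) A) ^^ k) (mat 1)"

definition psd_le :: "real^'n^'n \<Rightarrow> real^'n^'n \<Rightarrow> bool" (infix "\<preceq>" 50) where
  "A \<preceq> B \<longleftrightarrow> transpose (B - A) = B - A \<and> (\<forall>x. 0 \<le> x \<bullet> ((B - A) *v x))"

definition outer_prod :: "real^'m \<Rightarrow> real^'n \<Rightarrow> real^'n^'m" where
  "outer_prod u v = (\<chi> i j. u $ i * v $ j)"

definition block_matrix ::
  "real^'a^'a \<Rightarrow> real^'b^'a \<Rightarrow> real^'a^'b \<Rightarrow> real^'b^'b \<Rightarrow> real^('a + 'b)^('a + 'b)" where
  "block_matrix X Y Z W = (\<chi> i j.
     case i of
       Inl a \<Rightarrow> (case j of Inl b \<Rightarrow> X $ a $ b | Inr b \<Rightarrow> Y $ a $ b)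
     | Inr a \<Rightarrow> (case j of Inl b \<Rightarrow> Z $ a $ b | Inr b \<Rightarrow> W $ a $ b))"

definition schur_stable :: "real^'n^'n \<Rightarrow> bool" where
  "schur_stable A \<longleftrightarrow>
     (\<forall>(l::complex) (v::complex^'n).
        v \<noteq> 0 \<and> (\<chi> i j. complex_of_real (A $ i $ j)) *v v = l *s v \<longrightarrow> cmod l < 1)"

definition stabilizable :: "real^'p^'p \<Rightarrow> real^'q^'p \<Rightarrow> bool" where
  "stabilizable A B \<longleftrightarrow> (\<exists>K. schur_stable (A + B ** K))"

definition detectable :: "real^'p^'p \<Rightarrow> real^'p^'m \<Rightarrow> bool" where
  "detectable A C \<longleftrightarrow> (\<exists>L. schur_stable (A + L ** C))"

definition covariance_matrix :: "'w measure \<Rightarrow> ('w \<Rightarrow> real^'n) \<Rightarrow> real^'n^'n" where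
  "covariance_matrix M X =
     integral\<^sup>L M (\<lambda>\<omega>. outer_prod (X \<omega> - integral\<^sup>L M X) (X \<omega> - integral\<^sup>L M X))"

definition iid_zero_mean ::
  "'w measure \<Rightarrow> 'i set \<Rightarrow> ('i \<Rightarrow> 'w \<Rightarrow> real^'n) \<Rightarrow> real^'n^'n \<Rightarrow> bool" where
  "iid_zero_mean M I X \<Sigma> \<longleftrightarrow>
     prob_space.indep_vars M (\<lambda>_. borel) X I \<and>
     (\<forall>i\<in>I. \<forall>j\<in>I. distr M borel (X i) = distr M borel (X j)) \<and>
     (\<forall>i\<in>I. integrable M (\<lambda>\<omega>. (norm (X i \<omega>))\<^sup>2)) \<and>
     (\<forall>i\<in>I. integral\<^sup>L M (X i) = 0) \<and>
     (\<forall>i\<in>I. covariance_matrix M (X i) = \<Sigma>)"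

text \<open>Independence of two random elements that may take values in different types; the library's
  \<open>indep_var\<close> requires equal value types.\<close>

definition indep_random ::
  "'w measure \<Rightarrow> 'a measure \<Rightarrow> ('w \<Rightarrow> 'a) \<Rightarrow> 'b measure \<Rightarrow> ('w \<Rightarrow> 'b) \<Rightarrow> bool" where
  "indep_random M N X N' Y \<longleftrightarrow>
     X \<in> measurable M N \<and> Y \<in> measurable M N' \<and>
     prob_space.indep_set M {X -` U \<inter> space M |U. U \<in> sets N} {Y -` U \<inter> space M |U. U \<in> sets N'}"

definition switched :: "real \<Rightarrow> 'v \<Rightarrow> 'v \<Rightarrow> 'v::real_vector" where
  "switched a X Y = a *\<^sub>R X + (1 - a) *\<^sub>R Y"

definition closed_loop_matrix ::
  "real^'p^'p \<Rightarrow> real^'q^'p \<Rightarrow> real^'p^'q \<Rightarrow> real^'p^'m \<Rightarrow> real^'p^'m \<Rightarrow> real^'m^'p \<Rightarrow> real^'m^'p \<Rightarrow>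
   real \<Rightarrow> real^('p + 'p)^('p + 'p)" where
  "closed_loop_matrix A B K C\<^sub>1 C\<^sub>2 L\<^sub>1 L\<^sub>2 a =
     block_matrix (A + B ** K) (B ** K) 0 (A + switched a L\<^sub>1 L\<^sub>2 ** switched a C\<^sub>1 C\<^sub>2)"

definition Dbar :: "real^'p^'p \<Rightarrow> real^'p^'m \<Rightarrow> real^'m^'p \<Rightarrow> nat \<Rightarrow> nat \<Rightarrow> real^'p^'p" where
  "Dbar A C L n k = - matpow (A + L ** C) (n - 1 - k)"

definition Lbar :: "real^'p^'p \<Rightarrow> real^'p^'m \<Rightarrow> real^'m^'p \<Rightarrow> nat \<Rightarrow> nat \<Rightarrow> real^'m^'p" where
  "Lbar A C L n k = - (matpow (A + L ** C) (n - 1 - k) ** L)"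

definition free_error ::
  "real^'p^'p \<Rightarrow> real^'p^'m \<Rightarrow> real^'m^'p \<Rightarrow>
   (nat \<Rightarrow> 'w \<Rightarrow> real^'p) \<Rightarrow> (nat \<Rightarrow> 'w \<Rightarrow> real^'m) \<Rightarrow> nat \<Rightarrow> 'w \<Rightarrow> real^'p" where
  "free_error A C L w z n \<omega> =
     (\<Sum>k<n. Dbar A C L n k *v w k \<omega> + Lbar A C L n k *v z k \<omega>)"

definition residual_attack ::
  "real^'p^'p \<Rightarrow> real^'p^'m \<Rightarrow> real^'m^'p \<Rightarrow> (nat \<Rightarrow> 'w \<Rightarrow> real^'m) \<Rightarrow> nat \<Rightarrow> 'w \<Rightarrow> real^'m" where
  "residual_attack A C L v n \<omega> = C *v (\<Sum>k<n. Lbar A C L n k *v v k \<omega>) - v n \<omega>"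

definition free_second_moment ::
  "'w measure \<Rightarrow> real^'p^'p \<Rightarrow> real^'p^'m \<Rightarrow> real^'m^'p \<Rightarrow>
   (nat \<Rightarrow> 'w \<Rightarrow> real^'p) \<Rightarrow> (nat \<Rightarrow> 'w \<Rightarrow> real^'m) \<Rightarrow> nat \<Rightarrow> real^'m^'m" where
  "free_second_moment M A C L w z n =
     integral\<^sup>L M (\<lambda>\<omega>. outer_prod (C *v free_error A C L w z n \<omega> - z n \<omega>)
                              (C *v free_error A C L w z n \<omega> - z n \<omega>))"

definition covariance_test ::
  "(nat \<Rightarrow> real^'m^'m) \<Rightarrow> (nat \<Rightarrow> 'w \<Rightarrow> real^'m) \<Rightarrow> nat \<Rightarrow> 'w \<Rightarrow> real^'m^'m" where
  "covariance_test R d N \<omega> = (1 / real N) *\<^sub>R (\<Sum>n<N. outer_prod (d n \<omega>) (d n \<omega>) - R n)"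

text \<open>The watermark is indexed by integers because \<open>n - k' - 1\<close> can be negative.\<close>

definition watermark_test ::
  "nat \<Rightarrow> (nat \<Rightarrow> 'w \<Rightarrow> real^'m) \<Rightarrow> (int \<Rightarrow> 'w \<Rightarrow> real^'q) \<Rightarrow> nat \<Rightarrow> 'w \<Rightarrow> real^'q^'m" where
  "watermark_test k' d e N \<omega> =
     (1 / real N) *\<^sub>R (\<Sum>n<N. outer_prod (d n \<omega>) (e (int n - int k' - 1) \<omega>))"

definition threshold :: "real \<Rightarrow> real \<Rightarrow> nat \<Rightarrow> real" where
  "threshold \<rho> S N = sqrt ((1 + \<rho>) * S * ln (real N) / real N)"

definition detection_event ::
  "'w measure \<Rightarrow> (nat \<Rightarrow> 'w \<Rightarrow> real^'m^'m) \<Rightarrow> (nat \<Rightarrow> 'w \<Rightarrow> real^'q^'m) \<Rightarrow> (nat \<Rightarrow> real) \<Rightarrow>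
   nat \<Rightarrow> 'w set" where
  "detection_event M \<Phi>\<^sub>1 \<Phi>\<^sub>2 t N =
     {\<omega> \<in> space M. spectral_norm (\<Phi>\<^sub>1 N \<omega>) > t N} \<union> {\<omega> \<in> space M. spectral_norm (\<Phi>\<^sub>2 N \<omega>) > t N}"

text \<open>The rule determines \<open>a N\<close> for \<open>N \<ge> 1\<close>. The values of \<open>a\<close> at indices \<open>\<le> 0\<close> form an arbitrary
  initial history, which clause (ii) consults while \<open>N \<le> \<tau>\<close>.\<close>

definition switching_rule ::
  "nat \<Rightarrow> (nat \<Rightarrow> real) \<Rightarrow> (nat \<Rightarrow> real^'m^'m) \<Rightarrow> (nat \<Rightarrow> real^'q^'m) \<Rightarrow> (int \<Rightarrow> real) \<Rightarrow> bool" where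
  "switching_rule \<tau> t \<Phi>\<^sub>1 \<Phi>\<^sub>2 a \<longleftrightarrow>
     (\<forall>N\<ge>1. a (int N) =
       (if spectral_norm (\<Phi>\<^sub>1 N) \<ge> t N \<or> spectral_norm (\<Phi>\<^sub>2 N) \<ge> t N then 0
        else if a (int N - 1) = 0 \<and> (\<forall>i\<in>{1..\<tau>}. a (int N - int i) = 0) then 1
        else a (int N - 1)))"

definition Kbar ::
  "real^'p^'p \<Rightarrow> real^'p^'m \<Rightarrow> real^'m^'p \<Rightarrow> real \<Rightarrow> real \<Rightarrow> nat \<Rightarrow> real" where
  "Kbar A C L Kw Kz n =
     Kz + (\<Sum>k<n. spectral_norm (C ** Dbar A C L n k) * Kw + spectral_norm (C ** Lbar A C L n k) * Kz)"

definition c1 :: "(nat \<Rightarrow> real) \<Rightarrow> nat \<Rightarrow> real" where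
  "c1 Kb N = 8 * (\<Sum>k<N. Kb k ^ 4)"

definition c2 ::
  "(nat \<Rightarrow> real) \<Rightarrow> (nat \<Rightarrow> real^'m^'m) \<Rightarrow> real \<Rightarrow> real^'q^'q \<Rightarrow> nat \<Rightarrow> real" where
  "c2 Kb R Ke \<Sigma>e N =
     (\<Sum>k<N. max ((Ke\<^sup>2 + trace \<Sigma>e) * spectral_norm (R k))
                  ((Kb k)\<^sup>2 * (Ke\<^sup>2 + spectral_norm \<Sigma>e)))"

definition c3 ::
  "'w measure \<Rightarrow> (int \<Rightarrow> 'w \<Rightarrow> real^'q) \<Rightarrow> real \<Rightarrow> real^'q^'q \<Rightarrow> nat \<Rightarrow> real" where
  "c3 M e Ke \<Sigma>e N =
     spectral_norm (\<Sum>k<N.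
       matpow (Ke\<^sup>2 *\<^sub>R mat 1 - \<Sigma>e) 2
       + integral\<^sup>L M (\<lambda>\<omega>. matpow (outer_prod (e (int k) \<omega>) (e (int k) \<omega>)) 2)
       - matpow \<Sigma>e 2)"

end

theory Submission
  imports Defs
begin

text \<open>The residual is \<open>d n = r n + V n\<close>, where \<open>r n = C *v free_error n - \<zeta> n\<close> is the
  residual without attack and \<open>V n\<close> is the contribution of the attack.  The hypothesis says
  that \<open>\<Sum>k<N. norm (V k)\<close> is at most \<open>G\<close>, whatever \<open>N\<close>.  As \<open>r\<close> and the watermark are bounded,
  replacing \<open>d\<close> by \<open>r\<close> changes \<open>N *\<^sub>R \<Phi>\<^sub>1 N\<close> and \<open>N *\<^sub>R \<Phi>\<^sub>2 N\<close> by a bounded amount, which is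
  negligible against \<open>N * threshold \<rho> S N\<close>, a quantity of order \<open>sqrt (N * ln N)\<close>.  It remains
  to bound the two tests without attack.

  By the law of the iterated logarithm one expects their fluctuations to be of order
  \<open>sqrt (N * ln (ln N))\<close> before division by \<open>N\<close>.  The proof does not reach this sharp order, but
  the gap leaves room to show that they are eventually below \<open>c * sqrt (N * ln N)\<close> for every
  \<open>c > 0\<close>.  Boundedness of \<open>r\<close> comes from \<open>Kbar\<close>, which is bounded because it is monotone
  and the averages of its fourth powers are bounded by \<open>S / 8\<close>.  The difficulty is that the
  summands \<open>r n (r n)\<^sup>T - R n\<close> are not martingale differences, since the same noise enters many
  residuals, and that a union bound over all \<open>N\<close> is too wasteful for arbitrary \<open>c\<close>.  Two
  devices overcome this.

  \<^item> Fourth moments.  An entry of \<open>r n\<close> is a moving average \<open>\<Sum>l\<le>n. f l (\<xi> (n - l))\<close> of independent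
    bounded variables, with \<open>\<Sum>l. a l\<close> finite for \<open>\<bar>f l\<bar> \<le> a l\<close>; so, trivially, is the watermark.
    Expanding a product of two moving averages, each pair of lags \<open>(l, l')\<close> contributes a sum
    of martingale differences, whose fourth moment over a window of length \<open>m\<close> is of order
    \<open>(a l * b l') ^ 4 * m\<^sup>2\<close> (lemmas \<open>fourth_moment_sum\<close>, \<open>lagged_product_fourth_moment\<close>).  The
    triangle inequality in \<open>L\<^sup>4\<close>, in the form \<open>fourth_moment_sum_weighted\<close>, sums over the lags.

  \<^item> Maxima.  Dyadic chaining turns these bounds for all windows into a bound for the maximum
    over \<open>N < 2 ^ J\<close> (\<open>prob_dyadic_maximum\<close>): it exceeds \<open>\<kappa> * sqrt (J * 2 ^ J)\<close> with probability
    of order \<open>1 / J\<^sup>2\<close>, for every \<open>\<kappa> > 0\<close>.  This is summable in \<open>J\<close>, and \<open>J\<close> is of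
    order \<open>ln N\<close>, so the Borel-Cantelli lemma finishes the argument
    (\<open>eventually_le_sqrt_n_ln_n\<close>, \<open>moving_average_product_deviation\<close>).\<close>

section \<open>Essentially bounded random variables\<close>

definition ess_bounded :: "'w measure \<Rightarrow> ('w \<Rightarrow> real) \<Rightarrow> bool" where
  "ess_bounded M X \<longleftrightarrow> X \<in> borel_measurable M \<and> (\<exists>c. AE \<omega> in M. \<bar>X \<omega>\<bar> \<le> c)"

lemma ess_boundedI:
  "X \<in> borel_measurable M \<Longrightarrow> AE \<omega> in M. \<bar>X \<omega>\<bar> \<le> c \<Longrightarrow> ess_bounded M X"
  by (auto simp: ess_bounded_def)

lemma ess_bounded_measurable: "ess_bounded M X \<Longrightarrow> X \<in> borel_measurable M"
  by (simp add: ess_bounded_def)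

lemma ess_bounded_const [simp, intro]: "ess_bounded M (\<lambda>_. c)"
  by (rule ess_boundedI[where c="\<bar>c\<bar>"]) auto

lemma ess_bounded_add [intro]:
  assumes "ess_bounded M X" "ess_bounded M Y"
  shows "ess_bounded M (\<lambda>\<omega>. X \<omega> + Y \<omega>)"
proof -
  obtain c d where "AE \<omega> in M. \<bar>X \<omega>\<bar> \<le> c" "AE \<omega> in M. \<bar>Y \<omega>\<bar> \<le> d"
    using assms by (auto simp: ess_bounded_def)
  then have "AE \<omega> in M. \<bar>X \<omega> + Y \<omega>\<bar> \<le> c + d" by eventually_elim linarith
  then show ?thesis using assms
    by (intro ess_boundedI) (auto simp: ess_bounded_def)
qed

lemma ess_bounded_mult [intro]:
  assumes "ess_bounded M X" "ess_bounded M Y"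
  shows "ess_bounded M (\<lambda>\<omega>. X \<omega> * Y \<omega>)"
proof -
  obtain c d where "AE \<omega> in M. \<bar>X \<omega>\<bar> \<le> c" "AE \<omega> in M. \<bar>Y \<omega>\<bar> \<le> d"
    using assms by (auto simp: ess_bounded_def)
  then have "AE \<omega> in M. \<bar>X \<omega> * Y \<omega>\<bar> \<le> c * d"
    by eventually_elim (simp add: abs_mult mult_mono')
  then show ?thesis using assms
    by (intro ess_boundedI) (auto simp: ess_bounded_def)
qed

lemma ess_bounded_diff [intro]:
  assumes "ess_bounded M X" "ess_bounded M Y"
  shows "ess_bounded M (\<lambda>\<omega>. X \<omega> - Y \<omega>)"
  using ess_bounded_add[OF assms(1) ess_bounded_mult[OF ess_bounded_const[of M "-1"] assms(2)]]
  by simp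

lemma ess_bounded_power [intro]: "ess_bounded M X \<Longrightarrow> ess_bounded M (\<lambda>\<omega>. X \<omega> ^ n)"
  by (induction n) auto

lemma ess_bounded_sum [intro]:
  "(\<And>i. i \<in> I \<Longrightarrow> ess_bounded M (X i)) \<Longrightarrow> ess_bounded M (\<lambda>\<omega>. \<Sum>i\<in>I. X i \<omega>)"
  by (induction I rule: infinite_finite_induct) auto

lemma (in finite_measure) ess_bounded_integrable: "ess_bounded M X \<Longrightarrow> integrable M X"
  unfolding ess_bounded_def by (auto intro!: integrable_const_bound)

section \<open>Fourth moments of sums\<close>

lemma (in prob_space) integral_le_const_AE:
  fixes X :: "'a \<Rightarrow> real"
  assumes "integrable M X" "AE \<omega> in M. X \<omega> \<le> c"
  shows "expectation X \<le> c"
  using integral_mono_AE[OF assms(1) integrable_const[of c] assms(2)] prob_space by simp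

text \<open>A discrete Burkholder inequality.  Expanding \<open>(s + x) ^ 4\<close>, orthogonality removes the term
  \<open>4 * s ^ 3 * x\<close>; the term \<open>4 * s * x ^ 3\<close> is absorbed into \<open>x\<^sup>2 * (s\<^sup>2 + x\<^sup>2)\<close>, and the second moment
  grows only linearly.  Orthogonality of each summand to the powers of the preceding partial sum
  takes the place of a condition on conditional expectations.\<close>

lemma (in prob_space) fourth_moment_sum:
  fixes D :: "nat \<Rightarrow> 'a \<Rightarrow> real"
  assumes meas: "\<And>n. D n \<in> borel_measurable M"
    and bd: "\<And>n. AE \<omega> in M. \<bar>D n \<omega>\<bar> \<le> c"
    and orth: "\<And>n p. expectation (\<lambda>\<omega>. (\<Sum>i<n. D i \<omega>) ^ p * D n \<omega>) = 0"
  shows "expectation (\<lambda>\<omega>. (\<Sum>i<n. D i \<omega>) ^ 4) \<le> 4 * c ^ 4 * real n ^ 2"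
proof -
  define S where "S n \<omega> = (\<Sum>i<n. D i \<omega>)" for n \<omega>
  have eD: "ess_bounded M (D n)" for n using meas bd by (rule ess_boundedI)
  have eS: "ess_bounded M (S n)" for n unfolding S_def using eD by auto
  have int: "integrable M (\<lambda>\<omega>. S n \<omega> ^ p * D n \<omega> ^ q)" for n p q
    by (intro ess_bounded_integrable ess_bounded_mult ess_bounded_power eD eS)
  have intS: "integrable M (\<lambda>\<omega>. S n \<omega> ^ p)" for n p
    using int[of n p 0] by simp
  have D2: "AE \<omega> in M. D n \<omega> ^ 2 \<le> c ^ 2" for n
    using bd[of n] by eventually_elim (metis abs_ge_zero power2_abs power_mono)
  have two: "expectation (\<lambda>\<omega>. S n \<omega> ^ 2) \<le> c ^ 2 * real n" for n
  proof (induction n)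
    case (Suc n)
    have eq: "S (Suc n) \<omega> ^ 2 = S n \<omega> ^ 2 + 2 * (S n \<omega> ^ 1 * D n \<omega>) + D n \<omega> ^ 2" for \<omega>
      by (simp add: S_def power2_eq_square algebra_simps)
    have "expectation (\<lambda>\<omega>. S (Suc n) \<omega> ^ 2)
        = expectation (\<lambda>\<omega>. S n \<omega> ^ 2) + 2 * expectation (\<lambda>\<omega>. S n \<omega> ^ 1 * D n \<omega>)
          + expectation (\<lambda>\<omega>. D n \<omega> ^ 2)"
      unfolding eq using int[of n 2 0] int[of n 1 1] int[of n 0 2] by simp
    also have "expectation (\<lambda>\<omega>. D n \<omega> ^ 2) \<le> c ^ 2"
      using int[of n 0 2] D2 by (intro integral_le_const_AE) auto
    also have "expectation (\<lambda>\<omega>. S n \<omega> ^ 1 * D n \<omega>) = 0"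
      unfolding S_def by (rule orth)
    finally show ?case using Suc by (simp add: algebra_simps)
  qed (simp add: S_def)
  have "expectation (\<lambda>\<omega>. S n \<omega> ^ 4) \<le> 4 * c ^ 4 * real n ^ 2"
  proof (induction n)
    case (Suc n)
    have le: "AE \<omega> in M. S (Suc n) \<omega> ^ 4
        \<le> S n \<omega> ^ 4 + 4 * (S n \<omega> ^ 3 * D n \<omega>) + 8 * c ^ 2 * S n \<omega> ^ 2 + 3 * c ^ 4"
      using D2[of n]
    proof eventually_elim
      case (elim \<omega>)
      let ?s = "S n \<omega>" and ?x = "D n \<omega>"
      have "(?s + ?x) ^ 4 = ?s ^ 4 + 4 * (?s ^ 3 * ?x) + 6 * ?s ^ 2 * ?x ^ 2 + 4 * ?s * ?x ^ 3 + ?x ^ 4"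
        by (simp add: eval_nat_numeral algebra_simps)
      moreover have "4 * ?s * ?x ^ 3 \<le> 2 * ?s ^ 2 * ?x ^ 2 + 2 * ?x ^ 4"
      proof -
        have "0 \<le> 2 * ?x ^ 2 * (?s - ?x) ^ 2" by simp
        then show ?thesis by (simp add: eval_nat_numeral algebra_simps)
      qed
      moreover have "?s ^ 2 * ?x ^ 2 \<le> ?s ^ 2 * c ^ 2" using elim by (intro mult_left_mono) auto
      moreover have "?x ^ 4 \<le> c ^ 4"
        using power_mono[OF elim, of 2] by simp
      ultimately show ?case by (simp add: S_def algebra_simps)
    qed
    have "expectation (\<lambda>\<omega>. S (Suc n) \<omega> ^ 4) \<le> expectation (\<lambda>\<omega>.
        S n \<omega> ^ 4 + 4 * (S n \<omega> ^ 3 * D n \<omega>) + 8 * c ^ 2 * S n \<omega> ^ 2 + 3 * c ^ 4)"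
      using int[of n 3 1] by (intro integral_mono_AE[OF _ _ le] Bochner_Integration.integrable_add
          integrable_mult_right intS) auto
    also have "\<dots> = expectation (\<lambda>\<omega>. S n \<omega> ^ 4) + 4 * expectation (\<lambda>\<omega>. S n \<omega> ^ 3 * D n \<omega>)
        + 8 * c ^ 2 * expectation (\<lambda>\<omega>. S n \<omega> ^ 2) + 3 * c ^ 4"
      using int[of n 3 1] intS[of n 4] intS[of n 2] prob_space by simp
    also have "expectation (\<lambda>\<omega>. S n \<omega> ^ 3 * D n \<omega>) = 0"
      unfolding S_def by (rule orth)
    also have "8 * c ^ 2 * expectation (\<lambda>\<omega>. S n \<omega> ^ 2) \<le> 8 * c ^ 2 * (c ^ 2 * real n)"
      by (intro mult_left_mono two) auto
    finally have "expectation (\<lambda>\<omega>. S (Suc n) \<omega> ^ 4) \<le> 4 * c ^ 4 * (real n ^ 2 + 2 * real n) + 3 * c ^ 4"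
      using Suc by (simp add: eval_nat_numeral algebra_simps)
    also have "\<dots> = 4 * c ^ 4 * real (Suc n) ^ 2 - c ^ 4"
      by (simp add: eval_nat_numeral algebra_simps)
    also have "\<dots> \<le> 4 * c ^ 4 * real (Suc n) ^ 2" by simp
    finally show ?case .
  qed (simp add: S_def)
  then show ?thesis unfolding S_def .
qed

text \<open>Jensen's inequality for the fourth power, with weights proportional to \<open>c\<close>.\<close>

lemma fourth_power_sum_le:
  fixes c t :: "'i \<Rightarrow> real"
  assumes "finite I" and pos: "\<And>i. i \<in> I \<Longrightarrow> 0 < c i"
  shows "(\<Sum>i\<in>I. t i) ^ 4 \<le> (\<Sum>i\<in>I. c i) ^ 3 * (\<Sum>i\<in>I. t i ^ 4 / c i ^ 3)"
proof (cases "I = {}")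
  case False
  define C where "C = (\<Sum>i\<in>I. c i)"
  have C: "C > 0" unfolding C_def using assms False by (intro sum_pos) auto
  have "(\<Sum>i\<in>I. (c i / C) *\<^sub>R (C * t i / c i)) ^ 4 \<le> (\<Sum>i\<in>I. (c i / C) * (C * t i / c i) ^ 4)"
  proof (rule convex_on_sum[OF \<open>finite I\<close> False convex_power_even])
    show "(\<Sum>i\<in>I. c i / C) = 1" using C by (simp add: C_def flip: sum_divide_distrib)
    show "0 \<le> c i / C" if "i \<in> I" for i using pos[OF that] C by simp
  qed auto
  also have "(\<Sum>i\<in>I. (c i / C) *\<^sub>R (C * t i / c i)) = (\<Sum>i\<in>I. t i)"
    using C pos by (intro sum.cong) (force simp: field_simps)+
  also have "(\<Sum>i\<in>I. (c i / C) * (C * t i / c i) ^ 4) = (\<Sum>i\<in>I. C ^ 3 * (t i ^ 4 / c i ^ 3))"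
  proof (rule sum.cong[OF refl])
    fix i assume "i \<in> I"
    from pos[OF this] show "(c i / C) * (C * t i / c i) ^ 4 = C ^ 3 * (t i ^ 4 / c i ^ 3)"
      using C by (simp add: eval_nat_numeral field_simps)
  qed
  finally show ?thesis by (simp add: C_def sum_distrib_left)
qed simp

text \<open>This replaces Minkowski's inequality in \<open>L\<^sup>4\<close>: the bounds \<open>c i * K powr (1/4)\<close> on the
  \<open>L\<^sup>4\<close> norms of the summands add up.\<close>

lemma (in prob_space) fourth_moment_sum_weighted:
  fixes T :: "'i \<Rightarrow> 'a \<Rightarrow> real"
  assumes fin: "finite I" and pos: "\<And>i. i \<in> I \<Longrightarrow> 0 < c i"
    and eb: "\<And>i. i \<in> I \<Longrightarrow> ess_bounded M (T i)"
    and le: "\<And>i. i \<in> I \<Longrightarrow> expectation (\<lambda>\<omega>. T i \<omega> ^ 4) \<le> c i ^ 4 * K"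
  shows "expectation (\<lambda>\<omega>. (\<Sum>i\<in>I. T i \<omega>) ^ 4) \<le> (\<Sum>i\<in>I. c i) ^ 4 * K"
proof -
  let ?C = "\<Sum>i\<in>I. c i"
  have int: "integrable M (\<lambda>\<omega>. T i \<omega> ^ 4)" if "i \<in> I" for i
    by (intro ess_bounded_integrable ess_bounded_power eb that)
  have C: "?C \<ge> 0" using pos by (intro sum_nonneg) force
  have "expectation (\<lambda>\<omega>. (\<Sum>i\<in>I. T i \<omega>) ^ 4)
      \<le> expectation (\<lambda>\<omega>. ?C ^ 3 * (\<Sum>i\<in>I. T i \<omega> ^ 4 / c i ^ 3))"
    using int by (intro integral_mono fourth_power_sum_le fin pos
        ess_bounded_integrable[OF ess_bounded_power] ess_bounded_sum eb) auto
  also have "\<dots> = ?C ^ 3 * (\<Sum>i\<in>I. expectation (\<lambda>\<omega>. T i \<omega> ^ 4) / c i ^ 3)"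
    using int by simp
  also have "\<dots> \<le> ?C ^ 3 * (\<Sum>i\<in>I. c i * K)"
  proof (intro mult_left_mono sum_mono)
    fix i assume i: "i \<in> I"
    show "expectation (\<lambda>\<omega>. T i \<omega> ^ 4) / c i ^ 3 \<le> c i * K"
      using le[OF i] pos[OF i] by (simp add: field_simps eval_nat_numeral)
  qed (use C in simp)
  also have "\<dots> = ?C ^ 4 * K" by (simp add: eval_nat_numeral flip: sum_distrib_right)
  finally show ?thesis .
qed

section \<open>Maxima by dyadic chaining\<close>

text \<open>Rounding \<open>N\<close> down to multiples of \<open>1, 2, 4, \<dots>, 2 ^ J\<close> leads from \<open>N\<close> to \<open>0\<close>; each rounding
  step either does nothing or crosses exactly one dyadic interval of its level.\<close>

lemma dyadic_chaining:
  fixes S :: "nat \<Rightarrow> real"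
  assumes "S 0 = 0"
    and inc: "\<And>l i. l < J \<Longrightarrow> i < 2 ^ (J - l) \<Longrightarrow> \<bar>S ((i + 1) * 2 ^ l) - S (i * 2 ^ l)\<bar> \<le> \<epsilon> l"
    and eps: "\<And>l. 0 \<le> \<epsilon> l"
    and N: "N < 2 ^ J"
  shows "\<bar>S N\<bar> \<le> (\<Sum>l<J. \<epsilon> l)"
proof -
  define F where "F l = N div 2 ^ l * 2 ^ l" for l
  have step: "\<bar>S (F l) - S (F (Suc l))\<bar> \<le> \<epsilon> l" if l: "l < J" for l
  proof -
    define q where "q = N div 2 ^ l"
    have F1: "F (Suc l) = q div 2 * 2 * 2 ^ l" and F0: "F l = q * 2 ^ l"
      by (simp_all add: F_def q_def flip: div_mult2_eq) (simp add: mult.commute)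
    show ?thesis
    proof (cases "even q")
      case True then show ?thesis using eps F1 F0 by simp
    next
      case False
      then have q: "q = q div 2 * 2 + 1" by presburger
      have "q < 2 ^ (J - l)"
      proof -
        have "N < 2 ^ l * 2 ^ (J - l)" using N l by (simp flip: power_add)
        then show ?thesis unfolding q_def by (metis less_mult_imp_div_less mult.commute)
      qed
      then have "q div 2 * 2 < 2 ^ (J - l)" using q by linarith
      from inc[OF l this] show ?thesis unfolding F0 F1 using q by metis
    qed
  qed
  have "S N = S (F 0) - S (F J)" using N assms(1) by (simp add: F_def)
  also have "\<dots> = (\<Sum>l<J. S (F l) - S (F (Suc l)))" by (rule sum_lessThan_telescope'[symmetric])
  also have "\<bar>\<dots>\<bar> \<le> (\<Sum>l<J. \<epsilon> l)"
    by (intro order_trans[OF sum_abs] sum_mono step) auto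
  finally show ?thesis .
qed

lemma (in prob_space) prob_gt_fourth_moment:
  assumes "ess_bounded M X" "expectation (\<lambda>\<omega>. X \<omega> ^ 4) \<le> B" "0 < \<epsilon>"
  shows "prob {\<omega> \<in> space M. \<epsilon> < \<bar>X \<omega>\<bar>} \<le> B / \<epsilon> ^ 4"
proof -
  have [measurable]: "X \<in> borel_measurable M" using assms ess_bounded_measurable by auto
  have "prob {\<omega> \<in> space M. \<epsilon> < \<bar>X \<omega>\<bar>} \<le> prob {\<omega> \<in> space M. X \<omega> ^ 4 \<ge> \<epsilon> ^ 4}"
  proof (rule finite_measure_mono)
    show "{\<omega> \<in> space M. \<epsilon> < \<bar>X \<omega>\<bar>} \<subseteq> {\<omega> \<in> space M. X \<omega> ^ 4 \<ge> \<epsilon> ^ 4}"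
    proof safe
      fix \<omega> assume "\<epsilon> < \<bar>X \<omega>\<bar>"
      then have "\<epsilon> ^ 4 \<le> \<bar>X \<omega>\<bar> ^ 4" using assms(3) by (intro power_mono) auto
      then show "\<epsilon> ^ 4 \<le> X \<omega> ^ 4" by simp
    qed
  qed measurable
  also have "\<dots> \<le> expectation (\<lambda>\<omega>. X \<omega> ^ 4) / \<epsilon> ^ 4"
    using assms by (intro integral_Markov_inequality_measure[where A="{}"]
        ess_bounded_integrable ess_bounded_power) auto
  also have "\<dots> \<le> B / \<epsilon> ^ 4" using assms by (intro divide_right_mono) auto
  finally show ?thesis .
qed

text \<open>Level \<open>l\<close> has \<open>2 ^ (J - l)\<close> intervals, and Markov's inequality for fourth moments bounds
  the probability that a given one has an increment above \<open>\<epsilon> l\<close> by \<open>C * 4 ^ l / \<epsilon> l ^ 4\<close>.  The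
  allowances \<open>\<epsilon> l\<close> decrease geometrically in \<open>J - l\<close> with ratio \<open>\<theta>\<close>.  The ratio must satisfy
  \<open>\<theta> < 1\<close>, so that the allowances sum up to a multiple of the largest, and \<open>\<theta> ^ 4 > 1/2\<close>, so that
  the probabilities of the levels do so as well.\<close>

lemma (in prob_space) prob_dyadic_maximum:
  fixes S :: "nat \<Rightarrow> 'a \<Rightarrow> real"
  assumes zero: "\<And>\<omega>. S 0 \<omega> = 0" and eb: "\<And>n. ess_bounded M (S n)"
    and mom: "\<And>s m. expectation (\<lambda>\<omega>. (S (s + m) \<omega> - S s \<omega>) ^ 4) \<le> C * real m ^ 2"
    and "C \<ge> 0" "0 < \<kappa>"  and J: "0 < J"
  shows "prob {\<omega> \<in> space M. \<exists>N<2^J. 9 * \<kappa> * sqrt (real J * 2 ^ J) < \<bar>S N \<omega>\<bar>}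
    \<le> 4 * C / \<kappa> ^ 4 * (1 / real J ^ 2)"
proof -
  \<comment> \<open>\<open>9/10\<close> satisfies both conditions: \<open>\<theta> / (1 - \<theta>) = 9\<close>, and \<open>\<theta> ^ 4 = 0.6561\<close>.\<close>
  define \<theta> :: real where "\<theta> = 9/10"
  define \<epsilon> where "\<epsilon> l = \<kappa> * sqrt (real J * 2 ^ J) * \<theta> ^ (J - l)" for l
  define A where "A l i = {\<omega> \<in> space M. \<epsilon> l < \<bar>S ((i + 1) * 2 ^ l) \<omega> - S (i * 2 ^ l) \<omega>\<bar>}" for l i
  have eps: "0 < \<epsilon> l" for l using assms by (simp add: \<epsilon>_def \<theta>_def)
  have \<theta>0: "\<theta> > 0" by (simp add: \<theta>_def)
  have [measurable]: "S n \<in> borel_measurable M" for n using eb ess_bounded_measurable by auto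
  have A [measurable]: "A l i \<in> events" for l i unfolding A_def by measurable
  have geom: "(\<Sum>l<J. x ^ (J - l)) \<le> x / (1 - x)" if "0 \<le> x" "x < 1" for x :: real
  proof -
    have "(\<Sum>l<J. x ^ (J - l)) = (\<Sum>l<J. x ^ Suc l)"
      by (subst sum.nat_diff_reindex[symmetric]) (auto simp: Suc_diff_Suc intro!: sum.cong)
    also have "\<dots> = x * (\<Sum>l<J. x ^ l)" by (simp add: sum_distrib_left)
    also have "\<dots> = x * ((1 - x ^ J) / (1 - x))" using that by (simp add: sum_gp_strict)
    also have "\<dots> \<le> x * (1 / (1 - x))" using that by (intro mult_left_mono divide_right_mono) auto
    finally show ?thesis by simp
  qed
  have sumeps: "(\<Sum>l<J. \<epsilon> l) \<le> 9 * \<kappa> * sqrt (real J * 2 ^ J)"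
  proof -
    have "(\<Sum>l<J. \<epsilon> l) = \<kappa> * sqrt (real J * 2 ^ J) * (\<Sum>l<J. \<theta> ^ (J - l))"
      by (simp add: \<epsilon>_def sum_distrib_left)
    also have "\<dots> \<le> \<kappa> * sqrt (real J * 2 ^ J) * (\<theta> / (1 - \<theta>))"
      using assms by (intro mult_left_mono geom) (auto simp: \<theta>_def)
    finally show ?thesis by (simp add: \<theta>_def)
  qed
  have pA: "prob (A l i) \<le> C / \<kappa> ^ 4 * (1 / real J ^ 2) * (((1/2) / \<theta> ^ 4) ^ (J - l) / 2 ^ (J - l))"
    if l: "l < J" for l i
  proof -
    have "prob (A l i) \<le> C * real (2 ^ l) ^ 2 / \<epsilon> l ^ 4" unfolding A_def
      using mom[of "i * 2 ^ l" "2 ^ l"] eps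
      by (intro prob_gt_fourth_moment ess_bounded_diff eb) (simp_all add: algebra_simps)
    also have "\<epsilon> l ^ 4 = \<kappa> ^ 4 * real J ^ 2 * (2 ^ J) ^ 2 * (\<theta> ^ 4) ^ (J - l)"
    proof -
      have "sqrt (real J * 2 ^ J) ^ 4 = (sqrt (real J * 2 ^ J) ^ 2) ^ 2"
        by (subst power_mult[symmetric]) simp
      also have "\<dots> = real J ^ 2 * (2 ^ J) ^ 2" by (simp add: power_mult_distrib)
      finally show ?thesis
        by (simp add: \<epsilon>_def power_mult_distrib flip: power_mult) (simp add: mult.commute)
    qed
    also have "(2::real) ^ J = 2 ^ l * 2 ^ (J - l)" using l by (simp flip: power_add)
    also have "C * real (2 ^ l) ^ 2
          / (\<kappa> ^ 4 * real J ^ 2 * (2 ^ l * 2 ^ (J - l)) ^ 2 * (\<theta> ^ 4) ^ (J - l))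
        = C / \<kappa> ^ 4 * (1 / real J ^ 2) * (1 / (2 ^ (J - l) * (\<theta> ^ 4) ^ (J - l)) / 2 ^ (J - l))"
      using assms by (simp add: \<theta>0 power2_eq_square)
    also have "1 / (2 ^ (J - l) * (\<theta> ^ 4) ^ (J - l)) = ((1/2) / \<theta> ^ 4) ^ (J - l)"
      by (simp add: power_divide)
    finally show ?thesis .
  qed
  have "prob {\<omega> \<in> space M. \<exists>N<2^J. 9 * \<kappa> * sqrt (real J * 2 ^ J) < \<bar>S N \<omega>\<bar>}
    \<le> prob (\<Union>l<J. \<Union>i<2 ^ (J - l). A l i)"
  proof (intro finite_measure_mono subsetI)
    fix \<omega> assume "\<omega> \<in> {\<omega> \<in> space M. \<exists>N<2^J. 9 * \<kappa> * sqrt (real J * 2 ^ J) < \<bar>S N \<omega>\<bar>}"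
    then obtain N where N: "\<omega> \<in> space M" "N < 2 ^ J" "9 * \<kappa> * sqrt (real J * 2 ^ J) < \<bar>S N \<omega>\<bar>"
      by auto
    show "\<omega> \<in> (\<Union>l<J. \<Union>i<2 ^ (J - l). A l i)"
    proof (rule ccontr)
      assume "\<omega> \<notin> (\<Union>l<J. \<Union>i<2 ^ (J - l). A l i)"
      then have "\<bar>S N \<omega>\<bar> \<le> (\<Sum>l<J. \<epsilon> l)"
        using N(1,2) zero eps by (intro dyadic_chaining[where S="\<lambda>n. S n \<omega>"])
          (auto simp: A_def not_less less_imp_le)
      with sumeps N(3) show False by linarith
    qed
  qed measurable
  also have "\<dots> \<le> (\<Sum>l<J. prob (\<Union>i<2 ^ (J - l). A l i))"
    by (intro finite_measure_subadditive_finite) auto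
  also have "\<dots> \<le> (\<Sum>l<J. \<Sum>i<2 ^ (J - l). prob (A l i))"
    by (intro sum_mono finite_measure_subadditive_finite) auto
  also have "\<dots> \<le> (\<Sum>l<J. \<Sum>i<(2::nat) ^ (J - l).
      C / \<kappa> ^ 4 * (1 / real J ^ 2) * (((1/2) / \<theta> ^ 4) ^ (J - l) / 2 ^ (J - l)))"
    by (intro sum_mono pA) auto
  also have "\<dots> = C / \<kappa> ^ 4 * (1 / real J ^ 2) * (\<Sum>l<J. ((1/2) / \<theta> ^ 4) ^ (J - l))"
    by (simp add: sum_distrib_left)
  also have "\<dots> \<le> C / \<kappa> ^ 4 * (1 / real J ^ 2) * 4"
  proof (intro mult_left_mono)
    have "(\<Sum>l<J. ((1/2) / \<theta> ^ 4) ^ (J - l)) \<le> ((1/2) / \<theta> ^ 4) / (1 - (1/2) / \<theta> ^ 4)"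
      by (rule geom) (auto simp: \<theta>_def power_divide)
    also have "\<dots> \<le> 4" by (simp add: \<theta>_def power_divide)
    finally show "(\<Sum>l<J. ((1/2) / \<theta> ^ 4) ^ (J - l)) \<le> 4" .
  qed (use assms in auto)
  finally show ?thesis by (simp add: mult.commute mult.left_commute)
qed

text \<open>Fourth moments are enough here, and second moments are not: the dyadic maxima have
  exceptional probabilities of order \<open>1 / J\<^sup>2\<close>, where Chebyshev's inequality would only offer the
  divergent \<open>1 / J\<close>.  Since the constant \<open>c\<close> is arbitrary, crude estimates of \<open>J\<close> and \<open>2 ^ J\<close> in
  terms of \<open>N\<close> suffice.\<close>

lemma (in prob_space) eventually_le_sqrt_n_ln_n:
  fixes S :: "nat \<Rightarrow> 'a \<Rightarrow> real"
  assumes zero: "\<And>\<omega>. S 0 \<omega> = 0" and eb: "\<And>n. ess_bounded M (S n)"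
    and mom: "\<And>s m. expectation (\<lambda>\<omega>. (S (s + m) \<omega> - S s \<omega>) ^ 4) \<le> C * real m ^ 2"
    and "C \<ge> 0" "0 < c"
  shows "AE \<omega> in M. \<forall>\<^sub>F N in sequentially. \<bar>S N \<omega>\<bar> \<le> c * sqrt (real N * ln (real N))"
proof -
  \<comment> \<open>\<open>27 = 9 * 3\<close>: the first factor comes from the chaining bound, the second from
      \<open>J * 2 ^ J \<le> 9 * N * ln N\<close> below.\<close>
  define \<kappa> where "\<kappa> = c / 27"
  have \<kappa>: "0 < \<kappa>" using assms by (simp add: \<kappa>_def)
  define A where "A J = {\<omega> \<in> space M. \<exists>N<2^J. 9 * \<kappa> * sqrt (real J * 2 ^ J) < \<bar>S N \<omega>\<bar>}" for J
  have [measurable]: "S n \<in> borel_measurable M" for n using eb ess_bounded_measurable by auto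
  have "summable (\<lambda>J. prob (A J))"
  proof (rule summable_comparison_test_ev)
    show "summable (\<lambda>J. 4 * C / \<kappa> ^ 4 * (1 / real J ^ 2))"
      using inverse_power_summable[of 2, where 'a=real]
      by (intro summable_mult) (simp add: inverse_eq_divide)
    show "\<forall>\<^sub>F J in sequentially. norm (prob (A J)) \<le> 4 * C / \<kappa> ^ 4 * (1 / real J ^ 2)"
      using eventually_gt_at_top[of 0]
    proof eventually_elim
      case (elim J)
      then show ?case unfolding A_def
        using prob_dyadic_maximum[of S C \<kappa> J] assms \<kappa> by simp
    qed
  qed
  then have "AE \<omega> in M. \<forall>\<^sub>F J in sequentially. \<omega> \<in> space M - A J"
    by (intro borel_cantelli_AE1) (simp_all add: A_def emeasure_eq_measure)
  then show ?thesis
  proof eventually_elim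
    case (elim \<omega>)
    then obtain J0 where J0: "\<And>J N. J \<ge> J0 \<Longrightarrow> N < 2 ^ J \<Longrightarrow> \<bar>S N \<omega>\<bar> \<le> 9 * \<kappa> * sqrt (real J * 2 ^ J)"
      unfolding eventually_sequentially A_def by (fastforce simp: not_less)
    show ?case using eventually_ge_at_top[of "2 ^ Suc J0"]
    proof eventually_elim
      case (elim N)
      have N2: "N \<ge> 2" using elim by (meson le_trans one_le_numeral self_le_power zero_less_Suc)
      obtain j where j: "2 ^ j \<le> N" "N < 2 ^ Suc j"
        using ex_power_ivl1[of 2 N] N2 by auto
      have "(2::nat) ^ Suc J0 < 2 ^ Suc j" using elim j by linarith
      then have "J0 < j" by simp
      then have "\<bar>S N \<omega>\<bar> \<le> 9 * \<kappa> * sqrt (real (Suc j) * 2 ^ Suc j)" using j by (intro J0) auto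
      also have "\<dots> \<le> 9 * \<kappa> * sqrt (9 * (real N * ln (real N)))"
      proof (intro mult_left_mono real_sqrt_le_mono)
        have jN: "2 ^ j \<le> real N" using j by (metis of_nat_le_iff of_nat_numeral of_nat_power)
        have "real j * ln 2 = ln (2 ^ j)" by (simp add: ln_realpow)
        also have "\<dots> \<le> ln (real N)" using jN by (intro ln_mono) auto
        finally have "real j * ln 2 \<le> ln (real N)" .
        moreover have "real j * (1/2) \<le> real j * ln 2"
          using exp_half_le2 by (intro mult_left_mono, subst ln_ge_iff) auto
        moreover have "1 \<le> real j" using \<open>J0 < j\<close> by simp
        ultimately have "real (Suc j) \<le> 4 * ln (real N)" unfolding of_nat_Suc by linarith
        then have "real (Suc j) * 2 ^ Suc j \<le> (4 * ln (real N)) * (2 * real N)"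
          using jN by (intro mult_mono) auto
        also have "\<dots> \<le> 9 * (real N * ln (real N))" using N2 by simp
        finally show "real (Suc j) * 2 ^ Suc j \<le> 9 * (real N * ln (real N))" .
      qed (use \<kappa> in auto)
      also have "\<dots> = c * sqrt (real N * ln (real N))"
        by (simp add: \<kappa>_def real_sqrt_mult)
      finally show ?case .
    qed
  qed
qed

section \<open>Products of moving averages of independent variables\<close>

text \<open>The natural filtration of \<open>\<xi>\<close>, shifted so that stage \<open>k\<close> knows \<open>\<xi> i\<close> only for \<open>i < k\<close>.  As a
  measure space on \<open>space M\<close> it lets the usual measurability rules decide that a quantity depends
  on the past only.\<close>

definition past :: "'w measure \<Rightarrow> 'b measure \<Rightarrow> (nat \<Rightarrow> 'w \<Rightarrow> 'b) \<Rightarrow> nat \<Rightarrow> 'w measure" where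
  "past M N \<xi> k = vimage_algebra (space M) (\<lambda>\<omega>. \<lambda>i\<in>{..<k}. \<xi> i \<omega>) (Pi\<^sub>M {..<k} (\<lambda>_. N))"

lemma measurable_past:
  assumes "\<And>i. \<xi> i \<in> measurable M N" "i < k"
  shows "\<xi> i \<in> measurable (past M N \<xi> k) N"
proof -
  have "(\<lambda>\<omega>. \<lambda>i\<in>{..<k}. \<xi> i \<omega>) \<in> measurable M (Pi\<^sub>M {..<k} (\<lambda>_. N))"
    using assms(1) by measurable
  from measurable_space[OF this]
  have "(\<lambda>\<omega>. \<lambda>i\<in>{..<k}. \<xi> i \<omega>) \<in> measurable (past M N \<xi> k) (Pi\<^sub>M {..<k} (\<lambda>_. N))"
    unfolding past_def by (intro measurable_vimage_algebra1) auto
  moreover have "(\<lambda>x. x i) \<in> measurable (Pi\<^sub>M {..<k} (\<lambda>_. N)) N"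
    using assms(2) by (intro measurable_component_singleton) auto
  ultimately have "(\<lambda>\<omega>. (\<lambda>i\<in>{..<k}. \<xi> i \<omega>) i) \<in> measurable (past M N \<xi> k) N"
    by (rule measurable_compose)
  then show ?thesis using assms(2) by simp
qed

lemma (in prob_space) indep_var_past:
  fixes U :: "'a \<Rightarrow> real" and g :: "'b \<Rightarrow> real"
  assumes ind: "indep_vars (\<lambda>_. N) \<xi> (UNIV::nat set)"
    and U: "U \<in> borel_measurable (past M N \<xi> k)" and g: "g \<in> borel_measurable N"
  shows "indep_var borel U borel (\<lambda>\<omega>. g (\<xi> k \<omega>))"
proof -
  let ?X = "\<lambda>\<omega>. \<lambda>i\<in>{..<k}. \<xi> i \<omega>" and ?Y = "\<lambda>\<omega>. \<lambda>i\<in>{k}. \<xi> i \<omega>"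
  have rv: "\<xi> i \<in> measurable M N" for i using ind by (auto simp: indep_vars_def)
  have X: "?X \<in> measurable M (Pi\<^sub>M {..<k} (\<lambda>_. N))" using rv by measurable
  have "indep_var (Pi\<^sub>M {..<k} (\<lambda>_. N)) ?X (Pi\<^sub>M {k} (\<lambda>_. N)) ?Y"
    by (rule indep_var_restrict[OF ind]) auto
  then have 1: "indep_set
      (sigma_sets (space M) {?X -` A \<inter> space M | A. A \<in> sets (Pi\<^sub>M {..<k} (\<lambda>_. N))})
      (sigma_sets (space M) {?Y -` A \<inter> space M | A. A \<in> sets (Pi\<^sub>M {k} (\<lambda>_. N))})"
    by (simp add: indep_var_eq)
  have gk: "(\<lambda>y. g (y k)) \<in> borel_measurable (Pi\<^sub>M {k} (\<lambda>_. N))"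
    using g by (intro measurable_compose[OF measurable_component_singleton]) auto
  have Y: "?Y \<in> measurable M (Pi\<^sub>M {k} (\<lambda>_. N))" using rv by measurable
  have sub: "sets (past M N \<xi> k) \<subseteq> events"
    unfolding past_def using X by (intro sets_image_in_sets) auto
  have "U \<in> borel_measurable M"
    using measurable_mono[of borel borel "past M N \<xi> k" M] sub U by (auto simp: past_def)
  moreover have "(\<lambda>\<omega>. g (\<xi> k \<omega>)) \<in> borel_measurable M" using rv g by measurable
  moreover have "sigma_sets (space M) {U -` A \<inter> space M | A. A \<in> sets borel}
      \<subseteq> sigma_sets (space M) {?X -` A \<inter> space M | A. A \<in> sets (Pi\<^sub>M {..<k} (\<lambda>_. N))}"
  proof (rule sigma_sets_mono, safe)
    fix A :: "real set" assume "A \<in> sets borel"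
    from measurable_sets[OF U this]
    show "U -` A \<inter> space M \<in> sigma_sets (space M) {?X -` A \<inter> space M | A. A \<in> sets (Pi\<^sub>M {..<k} (\<lambda>_. N))}"
      by (simp add: past_def sets_vimage_algebra)
  qed
  moreover have "sigma_sets (space M) {(\<lambda>\<omega>. g (\<xi> k \<omega>)) -` A \<inter> space M | A. A \<in> sets borel}
      \<subseteq> sigma_sets (space M) {?Y -` A \<inter> space M | A. A \<in> sets (Pi\<^sub>M {k} (\<lambda>_. N))}"
  proof (rule sigma_sets_mono, safe)
    fix A :: "real set" assume "A \<in> sets borel"
    from measurable_sets[OF gk this]
    have "?Y -` ((\<lambda>y. g (y k)) -` A \<inter> space (Pi\<^sub>M {k} (\<lambda>_. N))) \<inter> space M
        \<in> sigma_sets (space M) {?Y -` A \<inter> space M | A. A \<in> sets (Pi\<^sub>M {k} (\<lambda>_. N))}"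
      by blast
    also have "?Y -` ((\<lambda>y. g (y k)) -` A \<inter> space (Pi\<^sub>M {k} (\<lambda>_. N))) \<inter> space M
        = (\<lambda>\<omega>. g (\<xi> k \<omega>)) -` A \<inter> space M"
      using measurable_space[OF Y] by auto
    finally show "(\<lambda>\<omega>. g (\<xi> k \<omega>)) -` A \<inter> space M
        \<in> sigma_sets (space M) {?Y -` A \<inter> space M | A. A \<in> sets (Pi\<^sub>M {k} (\<lambda>_. N))}" .
  qed
  ultimately show ?thesis using 1
    unfolding indep_var_eq indep_sets2_eq by blast
qed

lemma (in prob_space) past_orthogonal:
  fixes U :: "'a \<Rightarrow> real" and g :: "'b \<Rightarrow> real"
  assumes "indep_vars (\<lambda>_. N) \<xi> (UNIV::nat set)"
    and "U \<in> borel_measurable (past M N \<xi> k)" and "g \<in> borel_measurable N"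
    and "ess_bounded M U" and "ess_bounded M (\<lambda>\<omega>. g (\<xi> k \<omega>))"
    and "expectation (\<lambda>\<omega>. g (\<xi> k \<omega>)) = 0"
  shows "expectation (\<lambda>\<omega>. U \<omega> * g (\<xi> k \<omega>)) = 0"
  using assms
    indep_var_lebesgue_integral[OF indep_var_past[OF assms(1-3)] ess_bounded_integrable ess_bounded_integrable]
  by simp

text \<open>For fixed lags the products form martingale differences: write each as a centred function of
  its most recent input \<open>\<xi> k\<close> times a function of the past of \<open>k\<close>.  For distinct lags the recent
  factor itself has mean zero, so that the expectation subtracted vanishes; for equal lags the
  whole centred product depends on \<open>\<xi> k\<close> alone.  All earlier terms have their inputs before \<open>k\<close>.
  Times before \<open>max l l'\<close> count as zero because there the inputs do not exist yet.\<close>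

lemma (in prob_space) lagged_product_fourth_moment:
  fixes f g :: "'b \<Rightarrow> real" and \<xi> :: "nat \<Rightarrow> 'a \<Rightarrow> 'b"
  defines "D \<equiv> \<lambda>l l' n \<omega>. if l \<le> n \<and> l' \<le> n
      then f (\<xi> (n - l) \<omega>) * g (\<xi> (n - l') \<omega>)
           - expectation (\<lambda>\<omega>. f (\<xi> (n - l) \<omega>) * g (\<xi> (n - l') \<omega>)) else 0"
  assumes ind: "indep_vars (\<lambda>_. N) \<xi> UNIV"
    and f: "f \<in> borel_measurable N" and g: "g \<in> borel_measurable N"
    and fa: "\<And>k. AE \<omega> in M. \<bar>f (\<xi> k \<omega>)\<bar> \<le> a" and gb: "\<And>k. AE \<omega> in M. \<bar>g (\<xi> k \<omega>)\<bar> \<le> b"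
    and f0: "\<And>k. expectation (\<lambda>\<omega>. f (\<xi> k \<omega>)) = 0" and g0: "\<And>k. expectation (\<lambda>\<omega>. g (\<xi> k \<omega>)) = 0"
    and a: "0 \<le> a" and b: "0 \<le> b"
  shows "expectation (\<lambda>\<omega>. (\<Sum>i<m. D l l' (s + i) \<omega>) ^ 4) \<le> (a * b) ^ 4 * (64 * real m ^ 2)"
proof -
  have rv [measurable]: "\<xi> i \<in> measurable M N" for i using ind by (auto simp: indep_vars_def)
  note f [measurable] g [measurable]
  have ef: "ess_bounded M (\<lambda>\<omega>. f (\<xi> k \<omega>))" and eg: "ess_bounded M (\<lambda>\<omega>. g (\<xi> k \<omega>))" for k
    using fa gb by (auto intro!: ess_boundedI)
  have fp: "(\<lambda>\<omega>. f (\<xi> i \<omega>)) \<in> borel_measurable (past M N \<xi> k)"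
    and gp: "(\<lambda>\<omega>. g (\<xi> i \<omega>)) \<in> borel_measurable (past M N \<xi> k)" if "i < k" for i k
    using f g measurable_past[OF rv that] by (auto intro: measurable_compose)
  have eD: "ess_bounded M (D l l' n)" for n
    
  proof (cases "l \<le> n \<and> l' \<le> n")
    case False
    then have "D l l' n = (\<lambda>_. 0)" by (auto simp: D_def)
    then show ?thesis by simp
  qed (simp add: D_def ess_bounded_diff ess_bounded_mult ef eg)
  have bD: "AE \<omega> in M. \<bar>D l l' n \<omega>\<bar> \<le> 2 * (a * b)" for n
  proof -
    let ?P = "\<lambda>\<omega>. f (\<xi> (n - l) \<omega>) * g (\<xi> (n - l') \<omega>)"
    have le: "AE \<omega> in M. \<bar>?P \<omega>\<bar> \<le> a * b"
      using fa[of "n - l"] gb[of "n - l'"]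
      by eventually_elim (simp add: abs_mult mult_mono')
    have "integrable M ?P" by (intro ess_bounded_integrable ess_bounded_mult ef eg)
    then have "\<bar>expectation ?P\<bar> \<le> expectation (\<lambda>\<omega>. \<bar>?P \<omega>\<bar>)" by (intro integral_abs_bound)
    also have "\<dots> \<le> a * b"
      using le \<open>integrable M ?P\<close> by (intro integral_le_const_AE) auto
    finally have E: "\<bar>expectation ?P\<bar> \<le> a * b" .
    have "0 \<le> a * b" using a b by simp
    from le show ?thesis
    proof eventually_elim
      case (elim \<omega>)
      then show ?case
        using E \<open>0 \<le> a * b\<close> abs_triangle_ineq4[of "?P \<omega>" "expectation ?P"]
        by (auto simp: D_def)
    qed
  qed
  have orth: "expectation (\<lambda>\<omega>. (\<Sum>i<n. D l l' (s + i) \<omega>) ^ p * D l l' (s + n) \<omega>) = 0" for n p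
  proof (cases "l \<le> s + n \<and> l' \<le> s + n")
    case True
    \<comment> \<open>the index of the most recent input\<close>
    define k where "k = s + n - min l l'"
    define U where "U \<omega> = (\<Sum>i<n. D l l' (s + i) \<omega>) ^ p" for \<omega>
    have Up: "U \<in> borel_measurable (past M N \<xi> k)"
    proof -
      have "D l l' (s + i) \<in> borel_measurable (past M N \<xi> k)" if "i < n" for i
      proof (cases "l \<le> s + i \<and> l' \<le> s + i")
        case True
        then have "s + i - l < k" "s + i - l' < k" using that by (auto simp: k_def)
        then show ?thesis using True by (auto simp: D_def intro!: borel_measurable_diff borel_measurable_times fp gp)
      qed (auto simp: D_def)
      then show ?thesis unfolding U_def
        by (intro borel_measurable_power borel_measurable_sum) auto
    qed
    have Ue: "ess_bounded M U" unfolding U_def by (intro ess_bounded_power ess_bounded_sum eD)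
    consider "l = l'" | "l < l'" | "l' < l" by linarith
    then show ?thesis
    proof cases
      case 1
      let ?F = "\<lambda>x. f x * g x - expectation (\<lambda>\<omega>. f (\<xi> k \<omega>) * g (\<xi> k \<omega>))"
      have int: "integrable M (\<lambda>\<omega>. f (\<xi> k \<omega>) * g (\<xi> k \<omega>))"
        by (intro ess_bounded_integrable ess_bounded_mult ef eg)
      have "expectation (\<lambda>\<omega>. U \<omega> * ?F (\<xi> k \<omega>)) = 0"
        using int prob_space by (intro past_orthogonal[OF ind Up _ Ue] ess_bounded_diff ess_bounded_mult ef eg
          ess_bounded_const) auto
      then show ?thesis using True 1 by (simp add: U_def D_def k_def)
    next
      case 2
      have k: "s + n - l = k" "s + n - l' < k" using 2 True by (auto simp: k_def)
      have e0: "expectation (\<lambda>\<omega>. f (\<xi> k \<omega>) * g (\<xi> (s + n - l') \<omega>)) = 0"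
        using past_orthogonal[OF ind gp[OF k(2)] f eg ef f0] by (simp add: mult.commute)
      have "expectation (\<lambda>\<omega>. U \<omega> * g (\<xi> (s + n - l') \<omega>) * f (\<xi> k \<omega>)) = 0"
        using Up gp[OF k(2)] by (intro past_orthogonal[OF ind _ f _ ef f0] ess_bounded_mult Ue eg) auto
      then show ?thesis using True e0 by (simp add: U_def D_def k mult_ac)
    next
      case 3
      have k: "s + n - l' = k" "s + n - l < k" using 3 True by (auto simp: k_def)
      have e0: "expectation (\<lambda>\<omega>. f (\<xi> (s + n - l) \<omega>) * g (\<xi> k \<omega>)) = 0"
        by (rule past_orthogonal[OF ind fp[OF k(2)] g ef eg g0])
      have "expectation (\<lambda>\<omega>. U \<omega> * f (\<xi> (s + n - l) \<omega>) * g (\<xi> k \<omega>)) = 0"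
        using Up fp[OF k(2)] by (intro past_orthogonal[OF ind _ g _ eg g0] ess_bounded_mult Ue ef) auto
      then show ?thesis using True e0 by (simp add: U_def D_def k mult_ac)
    qed
  qed (auto simp: D_def)
  have "expectation (\<lambda>\<omega>. (\<Sum>i<m. D l l' (s + i) \<omega>) ^ 4) \<le> 4 * (2 * (a * b)) ^ 4 * real m ^ 2"
    using eD bD orth by (intro fourth_moment_sum) (auto intro: ess_bounded_measurable)
  then show "expectation (\<lambda>\<omega>. (\<Sum>i<m. D l l' (s + i) \<omega>) ^ 4) \<le> (a * b) ^ 4 * (64 * real m ^ 2)"
    by (simp add: power_mult_distrib)
qed

text \<open>Expanding the products over pairs of lags and adding the bounds for fixed lags gives a fourth
  moment of order \<open>m\<^sup>2\<close> for every window of length \<open>m\<close>, which is what chaining asks for.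
  The bounds \<open>a\<close> and \<open>b\<close> may vanish at some lags, whereas weights in Jensen's inequality have to be
  positive; adding \<open>(1/2) ^ l\<close> repairs this and costs at most \<open>2\<close> in the sums.\<close>

theorem (in prob_space) moving_average_product_deviation:
  fixes f g :: "nat \<Rightarrow> 'b \<Rightarrow> real" and \<xi> :: "nat \<Rightarrow> 'a \<Rightarrow> 'b"
  defines "X \<equiv> \<lambda>n \<omega>. \<Sum>l\<le>n. f l (\<xi> (n - l) \<omega>)"
    and "Y \<equiv> \<lambda>n \<omega>. \<Sum>l\<le>n. g l (\<xi> (n - l) \<omega>)"
  assumes ind: "indep_vars (\<lambda>_. N) \<xi> UNIV"
    and f: "\<And>l. f l \<in> borel_measurable N" and g: "\<And>l. g l \<in> borel_measurable N"
    and fa: "\<And>l k. AE \<omega> in M. \<bar>f l (\<xi> k \<omega>)\<bar> \<le> a l"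
    and gb: "\<And>l k. AE \<omega> in M. \<bar>g l (\<xi> k \<omega>)\<bar> \<le> b l"
    and f0: "\<And>l k. expectation (\<lambda>\<omega>. f l (\<xi> k \<omega>)) = 0"
    and g0: "\<And>l k. expectation (\<lambda>\<omega>. g l (\<xi> k \<omega>)) = 0"
    and a: "\<And>l. 0 \<le> a l" and b: "\<And>l. 0 \<le> b l"
    and Ha: "\<And>n. (\<Sum>l\<le>n. a l) \<le> H" and Hb: "\<And>n. (\<Sum>l\<le>n. b l) \<le> H'"
    and c: "0 < c"
  shows "AE \<omega> in M. \<forall>\<^sub>F n in sequentially.
    \<bar>\<Sum>k<n. X k \<omega> * Y k \<omega> - expectation (\<lambda>\<omega>. X k \<omega> * Y k \<omega>)\<bar> \<le> c * sqrt (real n * ln (real n))"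
proof -
  define a' b' where "a' l = a l + (1/2) ^ l" and "b' l = b l + (1/2) ^ l" for l
  have pos: "0 < a' l" "0 < b' l" for l using a[of l] b[of l] by (auto simp: a'_def b'_def add_nonneg_pos)
  have half: "(\<Sum>l\<le>n. (1/2) ^ l) \<le> (2::real)" for n
    using geometric_sum[of "1/2::real" "Suc n"] by (simp add: lessThan_Suc_atMost)
  have Ha': "(\<Sum>l\<le>n. a' l) \<le> H + 2" and Hb': "(\<Sum>l\<le>n. b' l) \<le> H' + 2" for n
    using Ha[of n] Hb[of n] half[of n] by (simp_all add: a'_def b'_def sum.distrib)
  have fa': "AE \<omega> in M. \<bar>f l (\<xi> k \<omega>)\<bar> \<le> a' l" for l k
    using fa[of l k] by eventually_elim (simp add: a'_def add_increasing2)
  have gb': "AE \<omega> in M. \<bar>g l (\<xi> k \<omega>)\<bar> \<le> b' l" for l k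
    using gb[of l k] by eventually_elim (simp add: b'_def add_increasing2)
  have rv [measurable]: "\<xi> i \<in> measurable M N" for i using ind by (auto simp: indep_vars_def)
  note f [measurable] g [measurable]
  have ef: "ess_bounded M (\<lambda>\<omega>. f l (\<xi> k \<omega>))" and eg: "ess_bounded M (\<lambda>\<omega>. g l (\<xi> k \<omega>))" for l k
    using fa gb by (auto intro!: ess_boundedI)
  have eX: "ess_bounded M (X n)" and eY: "ess_bounded M (Y n)" for n
    unfolding X_def Y_def using ef eg by auto
  define Z where "Z k \<omega> = X k \<omega> * Y k \<omega> - expectation (\<lambda>\<omega>. X k \<omega> * Y k \<omega>)" for k \<omega>
  define D where "D l l' n \<omega> = (if l \<le> n \<and> l' \<le> n
      then f l (\<xi> (n - l) \<omega>) * g l' (\<xi> (n - l') \<omega>)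
           - expectation (\<lambda>\<omega>. f l (\<xi> (n - l) \<omega>) * g l' (\<xi> (n - l') \<omega>)) else 0)" for l l' n \<omega>
  have eZ: "ess_bounded M (Z n)" for n unfolding Z_def
    by (intro ess_bounded_diff ess_bounded_mult ess_bounded_const eX eY)
  have eD: "ess_bounded M (D l l' n)" for l l' n
  proof (cases "l \<le> n \<and> l' \<le> n")
    case False
    then have "D l l' n = (\<lambda>_. 0)" by (auto simp: D_def)
    then show ?thesis by simp
  qed (simp add: D_def[abs_def] ess_bounded_diff ess_bounded_mult ef eg)
  have ZD: "Z n \<omega> = (\<Sum>(l,l')\<in>{..L}\<times>{..L}. D l l' n \<omega>)" if "n \<le> L" for n L \<omega>
  proof -
    have int: "integrable M (\<lambda>\<omega>. f l (\<xi> k \<omega>) * g l' (\<xi> k' \<omega>))" for l l' k k'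
      by (intro ess_bounded_integrable ess_bounded_mult ef eg)
    have XY: "X n \<omega> * Y n \<omega> = (\<Sum>(l,l')\<in>{..n}\<times>{..n}. f l (\<xi> (n - l) \<omega>) * g l' (\<xi> (n - l') \<omega>))" for \<omega>
      by (simp add: X_def Y_def sum_product sum.cartesian_product)
    have "Z n \<omega> = (\<Sum>(l,l')\<in>{..n}\<times>{..n}. f l (\<xi> (n - l) \<omega>) * g l' (\<xi> (n - l') \<omega>)
        - expectation (\<lambda>\<omega>. f l (\<xi> (n - l) \<omega>) * g l' (\<xi> (n - l') \<omega>)))"
      unfolding Z_def XY by (simp add: case_prod_beta int sum_subtractf)
    also have "\<dots> = (\<Sum>(l,l')\<in>{..n}\<times>{..n}. D l l' n \<omega>)"
      by (intro sum.cong) (auto simp: D_def)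
    also have "\<dots> = (\<Sum>(l,l')\<in>{..L}\<times>{..L}. D l l' n \<omega>)"
      using that by (intro sum.mono_neutral_left) (auto simp: D_def split: if_splits)
    finally show ?thesis .
  qed
  have "AE \<omega> in M. \<forall>\<^sub>F n in sequentially. \<bar>\<Sum>k<n. Z k \<omega>\<bar> \<le> c * sqrt (real n * ln (real n))"
  proof (rule eventually_le_sqrt_n_ln_n[where C="64 * ((H + 2) * (H' + 2)) ^ 4"])
    fix s m :: nat
    let ?I = "{..s + m} \<times> {..s + m}"
    have eq: "(\<Sum>k<s + m. Z k \<omega>) - (\<Sum>k<s. Z k \<omega>)
        = (\<Sum>(l,l')\<in>?I. \<Sum>i<m. D l l' (s + i) \<omega>)" for \<omega>
    proof -
      have "(\<Sum>k<s + m. Z k \<omega>) - (\<Sum>k<s. Z k \<omega>) = (\<Sum>i<m. Z (s + i) \<omega>)"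
        by (induction m) (auto simp: algebra_simps)
      also have "\<dots> = (\<Sum>i<m. \<Sum>(l,l')\<in>?I. D l l' (s + i) \<omega>)"
        by (intro sum.cong ZD) auto
      also have "\<dots> = (\<Sum>(l,l')\<in>?I. \<Sum>i<m. D l l' (s + i) \<omega>)"
        by (subst sum.swap) (simp add: case_prod_beta)
      finally show ?thesis .
    qed
    have "expectation (\<lambda>\<omega>. (\<Sum>p\<in>?I. \<Sum>i<m. D (fst p) (snd p) (s + i) \<omega>) ^ 4)
      \<le> (\<Sum>p\<in>?I. a' (fst p) * b' (snd p)) ^ 4 * (64 * real m ^ 2)"
    proof (intro fourth_moment_sum_weighted)
      fix p
      note lag = lagged_product_fourth_moment[OF ind f[of "fst p"] g[of "snd p"] fa'[of "fst p"]
          gb'[of "snd p"] f0[of "fst p"] g0[of "snd p"], of "fst p" s "snd p" m]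
      show "ess_bounded M (\<lambda>\<omega>. \<Sum>i<m. D (fst p) (snd p) (s + i) \<omega>)"
        by (intro ess_bounded_sum eD)
      show "expectation (\<lambda>\<omega>. (\<Sum>i<m. D (fst p) (snd p) (s + i) \<omega>) ^ 4)
        \<le> (a' (fst p) * b' (snd p)) ^ 4 * (64 * real m ^ 2)"
        using lag pos by (simp add: D_def less_imp_le)
    qed (use pos in auto)
    also have "(\<Sum>p\<in>?I. a' (fst p) * b' (snd p)) = (\<Sum>l\<le>s + m. a' l) * (\<Sum>l\<le>s + m. b' l)"
      by (simp add: sum_product sum.cartesian_product case_prod_beta)
    also have "((\<Sum>l\<le>s + m. a' l) * (\<Sum>l\<le>s + m. b' l)) ^ 4 * (64 * real m ^ 2)
        \<le> ((H + 2) * (H' + 2)) ^ 4 * (64 * real m ^ 2)"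
      using pos Ha' Hb' by (intro mult_right_mono power_mono mult_mono' sum_nonneg mult_nonneg_nonneg)
        (auto simp: less_imp_le)
    finally show "expectation (\<lambda>\<omega>. ((\<Sum>k<s + m. Z k \<omega>) - (\<Sum>k<s. Z k \<omega>)) ^ 4)
        \<le> 64 * ((H + 2) * (H' + 2)) ^ 4 * real m ^ 2"
      unfolding eq by (simp add: case_prod_beta mult_ac)
    show "ess_bounded M (\<lambda>\<omega>. \<Sum>k<n. Z k \<omega>)" for n by (intro ess_bounded_sum eZ)
  qed (use c in auto)
  then show ?thesis by (simp add: Z_def)
qed

section \<open>Independent families of pairs\<close>

context prob_space begin

lemma indep_random_compose:
  assumes ind: "indep_random M N X N' Y"
    and f: "f \<in> measurable N L" and g: "g \<in> measurable N' L'"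
  shows "indep_random M L (\<lambda>\<omega>. f (X \<omega>)) L' (\<lambda>\<omega>. g (Y \<omega>))"
proof -
  have X: "X \<in> measurable M N" and Y: "Y \<in> measurable M N'"
    using ind by (auto simp: indep_random_def)
  have sub: "{(\<lambda>\<omega>. h (Z \<omega>)) -` U \<inter> space M |U. U \<in> sets R} \<subseteq> {Z -` U \<inter> space M |U. U \<in> sets Q}"
    if Z: "Z \<in> measurable M Q" and h: "h \<in> measurable Q R"
    for Z :: "'a \<Rightarrow> 'x" and Q and h :: "'x \<Rightarrow> 'y" and R
  proof safe
    fix U assume U: "U \<in> sets R"
    have "(\<lambda>\<omega>. h (Z \<omega>)) -` U \<inter> space M = Z -` (h -` U \<inter> space Q) \<inter> space M"
      using measurable_space[OF Z] by blast
    then show "\<exists>V. (\<lambda>\<omega>. h (Z \<omega>)) -` U \<inter> space M = Z -` V \<inter> space M \<and> V \<in> sets Q"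
      using measurable_sets[OF h U] by blast
  qed
  have *: "indep_set {X -` U \<inter> space M |U. U \<in> sets N} {Y -` U \<inter> space M |U. U \<in> sets N'}"
    using ind by (simp add: indep_random_def)
  have "indep_set {(\<lambda>\<omega>. f (X \<omega>)) -` U \<inter> space M |U. U \<in> sets L}
      {(\<lambda>\<omega>. g (Y \<omega>)) -` U \<inter> space M |U. U \<in> sets L'}"
    using indep_setD[OF * subsetD[OF sub[OF X f]] subsetD[OF sub[OF Y g]]]
      subset_trans[OF sub[OF X f] indep_setD_ev1[OF *]] subset_trans[OF sub[OF Y g] indep_setD_ev2[OF *]]
    by (intro indep_setI)
  then show ?thesis
    using measurable_compose[OF X f] measurable_compose[OF Y g] by (simp add: indep_random_def)
qed

lemma indep_random_expectation_mult:
  fixes f g :: "_ \<Rightarrow> real"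
  assumes ind: "indep_random M N X N' Y"
    and f: "f \<in> borel_measurable N" and g: "g \<in> borel_measurable N'"
    and "ess_bounded M (\<lambda>\<omega>. f (X \<omega>))" "ess_bounded M (\<lambda>\<omega>. g (Y \<omega>))"
  shows "expectation (\<lambda>\<omega>. f (X \<omega>) * g (Y \<omega>)) = expectation (\<lambda>\<omega>. f (X \<omega>)) * expectation (\<lambda>\<omega>. g (Y \<omega>))"
proof (rule indep_var_lebesgue_integral)
  have sig: "sigma_sets (space M) {Z -` A \<inter> space M | A. A \<in> sets borel} = {Z -` A \<inter> space M | A. A \<in> sets borel}"
    for Z :: "'a \<Rightarrow> real"
    using sets_vimage_algebra[of "space M" Z borel] sets_vimage_algebra2[of Z "space M" borel] by simp
  show "indep_var borel (\<lambda>\<omega>. f (X \<omega>)) borel (\<lambda>\<omega>. g (Y \<omega>))"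
    using indep_random_compose[OF ind f g] unfolding indep_var_eq sig by (simp add: indep_random_def)
qed (use assms in \<open>auto intro: ess_bounded_integrable\<close>)

text \<open>Two mutually independent families of independent variables, paired index by index, form an
  independent family.  On rectangles the probability factorises first over the two families and
  then over the indices; rectangles are closed under intersection and generate the product
  \<open>\<sigma>\<close>-algebra.\<close>

lemma indep_vars_Pair:
  fixes X :: "'i \<Rightarrow> 'a \<Rightarrow> 'b" and Y :: "'i \<Rightarrow> 'a \<Rightarrow> 'c"
  assumes X: "indep_vars (\<lambda>_. N) X UNIV" and Y: "indep_vars (\<lambda>_. N') Y UNIV"
    and ind: "indep_random M (Pi\<^sub>M UNIV (\<lambda>_. N)) (\<lambda>\<omega> i. X i \<omega>) (Pi\<^sub>M UNIV (\<lambda>_. N')) (\<lambda>\<omega> i. Y i \<omega>)"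
  shows "indep_vars (\<lambda>_. N \<Otimes>\<^sub>M N') (\<lambda>i \<omega>. (X i \<omega>, Y i \<omega>)) UNIV"
proof -
  have rX [measurable]: "X i \<in> measurable M N" for i using X by (auto simp: indep_vars_def)
  have rY [measurable]: "Y i \<in> measurable M N'" for i using Y by (auto simp: indep_vars_def)
  define F where "F i = {X i -` A \<inter> Y i -` B \<inter> space M |A B. A \<in> sets N \<and> B \<in> sets N'}" for i
  have key: "prob (\<Inter>j\<in>J. X j -` A j \<inter> Y j -` B j \<inter> space M)
      = (\<Prod>j\<in>J. prob (X j -` A j \<inter> space M)) * (\<Prod>j\<in>J. prob (Y j -` B j \<inter> space M))"
    if J: "J \<noteq> {}" "finite J" and A: "\<And>j. j \<in> J \<Longrightarrow> A j \<in> sets N" and B: "\<And>j. j \<in> J \<Longrightarrow> B j \<in> sets N'"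
    for J A B
  proof -
    let ?A = "{x \<in> space (Pi\<^sub>M UNIV (\<lambda>_. N)). \<forall>j\<in>J. x j \<in> A j}"
      and ?B = "{y \<in> space (Pi\<^sub>M UNIV (\<lambda>_. N')). \<forall>j\<in>J. y j \<in> B j}"
    have m: "?A \<in> sets (Pi\<^sub>M UNIV (\<lambda>_. N))" "?B \<in> sets (Pi\<^sub>M UNIV (\<lambda>_. N'))"
      using A B J(2) by (auto intro!: sets.sets_Collect_finite_All measurable_sets_Collect[OF measurable_component_singleton])
    have preA: "(\<lambda>\<omega> i. X i \<omega>) -` ?A \<inter> space M = (\<Inter>j\<in>J. X j -` A j \<inter> space M)"
      and preB: "(\<lambda>\<omega> i. Y i \<omega>) -` ?B \<inter> space M = (\<Inter>j\<in>J. Y j -` B j \<inter> space M)"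
      using J(1) measurable_space[OF rX] measurable_space[OF rY] by (auto simp: space_PiM)
    have "(\<Inter>j\<in>J. X j -` A j \<inter> Y j -` B j \<inter> space M)
        = ((\<lambda>\<omega> i. X i \<omega>) -` ?A \<inter> space M) \<inter> ((\<lambda>\<omega> i. Y i \<omega>) -` ?B \<inter> space M)"
      unfolding preA preB by auto
    also have "prob \<dots> = prob ((\<lambda>\<omega> i. X i \<omega>) -` ?A \<inter> space M) * prob ((\<lambda>\<omega> i. Y i \<omega>) -` ?B \<inter> space M)"
      using ind m unfolding indep_random_def by (intro indep_setD) blast+
    also have "\<dots> = (\<Prod>j\<in>J. prob (X j -` A j \<inter> space M)) * (\<Prod>j\<in>J. prob (Y j -` B j \<inter> space M))"
      unfolding preA preB using J A B
      by (intro arg_cong2[where f="(*)"] indep_varsD[OF X] indep_varsD[OF Y]) auto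
    finally show ?thesis .
  qed
  have "indep_sets F UNIV"
  proof (rule indep_setsI)
    fix i show "F i \<subseteq> events"
    proof
      fix E assume "E \<in> F i"
      then obtain A B where AB: "E = X i -` A \<inter> Y i -` B \<inter> space M" "A \<in> sets N" "B \<in> sets N'"
        unfolding F_def by blast
      have "E = (X i -` A \<inter> space M) \<inter> (Y i -` B \<inter> space M)" using AB(1) by blast
      then show "E \<in> events" using AB(2,3) by (simp add: measurable_sets[OF rX] measurable_sets[OF rY])
    qed
  next
    fix E and J :: "'i set" assume J: "J \<noteq> {}" "finite J" and E: "\<forall>j\<in>J. E j \<in> F j"
    from E have "\<forall>j\<in>J. \<exists>A B. E j = X j -` A \<inter> Y j -` B \<inter> space M \<and> A \<in> sets N \<and> B \<in> sets N'"
      unfolding F_def by simp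
    then obtain A B where p: "\<And>j. j \<in> J \<Longrightarrow> E j = X j -` A j \<inter> Y j -` B j \<inter> space M"
      "\<And>j. j \<in> J \<Longrightarrow> A j \<in> sets N" "\<And>j. j \<in> J \<Longrightarrow> B j \<in> sets N'"
      unfolding bchoice_iff by blast
    have "prob (\<Inter>j\<in>J. E j) = (\<Prod>j\<in>J. prob (X j -` A j \<inter> space M) * prob (Y j -` B j \<inter> space M))"
      using key[OF J p(2,3)] p(1) by (simp add: prod.distrib)
    also have "\<dots> = (\<Prod>j\<in>J. prob (E j))"
    proof (rule prod.cong[OF refl])
      fix j assume "j \<in> J"
      then show "prob (X j -` A j \<inter> space M) * prob (Y j -` B j \<inter> space M) = prob (E j)"
        using key[of "{j}" A B] p by simp
    qed
    finally show "prob (\<Inter>j\<in>J. E j) = (\<Prod>j\<in>J. prob (E j))" .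
  qed
  moreover have "Int_stable (F i)" for i
  proof (rule Int_stableI)
    fix a b assume "a \<in> F i" "b \<in> F i"
    then obtain A B A' B' where ab: "a = X i -` A \<inter> Y i -` B \<inter> space M" "A \<in> sets N" "B \<in> sets N'"
      "b = X i -` A' \<inter> Y i -` B' \<inter> space M" "A' \<in> sets N" "B' \<in> sets N'" by (auto simp: F_def)
    then have "a \<inter> b = X i -` (A \<inter> A') \<inter> Y i -` (B \<inter> B') \<inter> space M" by auto
    then show "a \<inter> b \<in> F i" unfolding F_def using ab by blast
  qed
  ultimately have "indep_sets (\<lambda>i. sigma_sets (space M) (F i)) UNIV"
    by (intro indep_sets_sigma) auto
  then have "indep_sets (\<lambda>i. {(\<lambda>\<omega>. (X i \<omega>, Y i \<omega>)) -` C \<inter> space M |C. C \<in> sets (N \<Otimes>\<^sub>M N')}) UNIV"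
  proof (rule indep_sets_mono_sets)
    fix i
    have "{(\<lambda>\<omega>. (X i \<omega>, Y i \<omega>)) -` C \<inter> space M |C. C \<in> sets (N \<Otimes>\<^sub>M N')}
      = sigma_sets (space M) {(\<lambda>\<omega>. (X i \<omega>, Y i \<omega>)) -` C \<inter> space M |C.
          C \<in> {a \<times> b |a b. a \<in> sets N \<and> b \<in> sets N'}}"
      unfolding sets_pair_measure using measurable_space[OF rX] measurable_space[OF rY]
      by (intro sigma_sets_vimage_commute) auto
    also have "\<dots> \<subseteq> sigma_sets (space M) (F i)"
    proof (rule sigma_sets_mono, safe)
      fix a b assume "a \<in> sets N" "b \<in> sets N'"
      moreover have "(\<lambda>\<omega>. (X i \<omega>, Y i \<omega>)) -` (a \<times> b) \<inter> space M = X i -` a \<inter> Y i -` b \<inter> space M"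
        by auto
      ultimately show "(\<lambda>\<omega>. (X i \<omega>, Y i \<omega>)) -` (a \<times> b) \<inter> space M \<in> sigma_sets (space M) (F i)"
        unfolding F_def by (intro sigma_sets.Basic) auto
    qed
    finally show "{(\<lambda>\<omega>. (X i \<omega>, Y i \<omega>)) -` C \<inter> space M |C. C \<in> sets (N \<Otimes>\<^sub>M N')}
      \<subseteq> sigma_sets (space M) (F i)" .
  qed
  then show ?thesis unfolding indep_vars_def2 using rX rY by (intro conjI ballI) measurable
qed

end

lemma (in prob_space) indep_vars_reindex:
  assumes X: "indep_vars (\<lambda>_. N) X I" and h: "inj h" "range h \<subseteq> I"
  shows "indep_vars (\<lambda>_. N) (\<lambda>i. X (h i)) UNIV"
proof -
  have hI: "h j \<in> I" for j using h by blast
  have rX: "X i \<in> measurable M N" if "i \<in> I" for i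
    using X that by (simp add: indep_vars_def)
  have ind: "indep_sets (\<lambda>i. {X i -` A \<inter> space M |A. A \<in> sets N}) I"
    using X by (simp add: indep_vars_def2)
  have "indep_sets (\<lambda>i. {X (h i) -` A \<inter> space M |A. A \<in> sets N}) UNIV"
  proof (rule indep_setsI)
    show "{X (h i) -` A \<inter> space M |A. A \<in> sets N} \<subseteq> events" for i
      using measurable_sets[OF rX[OF hI[of i]]] by blast
  next
    fix E J assume J: "J \<noteq> {}" "finite J" and E: "\<forall>j\<in>J. E j \<in> {X (h j) -` A \<inter> space M |A. A \<in> sets N}"
    have inv: "inv h (h j) = j" for j using h by simp
    have "prob (\<Inter>i\<in>h ` J. E (inv h i)) = (\<Prod>i\<in>h ` J. prob (E (inv h i)))"
    proof (rule indep_setsD[OF ind])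
      show "\<forall>i\<in>h ` J. E (inv h i) \<in> {X i -` A \<inter> space M |A. A \<in> sets N}"
        using E by (simp add: inv)
      show "h ` J \<subseteq> I" using hI by blast
    qed (use J in simp_all)
    then show "prob (\<Inter>j\<in>J. E j) = (\<Prod>j\<in>J. prob (E j))"
      by (simp add: inv prod.reindex inj_on_subset[OF h(1)])
  qed
  then show ?thesis unfolding indep_vars_def2 using rX[OF hI] by blast
qed

section \<open>The spectral norm\<close>

lemma spectral_norm_le_sum_entries: "spectral_norm A \<le> (\<Sum>i\<in>UNIV. \<Sum>j\<in>UNIV. \<bar>A $ i $ j\<bar>)"
  unfolding spectral_norm_def by (rule onorm_le_matrix_component_sum)

lemma norm_matrix_vector_le: "norm (A *v x) \<le> spectral_norm A * norm x"
  unfolding spectral_norm_def by (rule onorm[OF matrix_vector_mul_bounded_linear])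

lemma spectral_norm_nonneg: "0 \<le> spectral_norm A"
  using onorm_pos_le[OF matrix_vector_mul_bounded_linear[of A]] by (simp add: spectral_norm_def)

lemma spectral_norm_uminus: "spectral_norm (- A) = spectral_norm A"
proof -
  have "(\<lambda>x. - A *v x) = (\<lambda>x. - (A *v x))"
    using matrix_vector_mult_diff_rdistrib[of 0 A] by auto
  then show ?thesis by (simp add: spectral_norm_def onorm_neg)
qed

text \<open>The spectral norm is continuous, since by the triangle inequality it varies by at most the sum
  of the absolute differences of the entries.\<close>

lemma borel_measurable_spectral_norm [measurable]: "spectral_norm \<in> borel_measurable borel"
proof (rule borel_measurable_continuous_onI, intro continuous_at_imp_continuous_on ballI)
  fix A :: "real^'n^'m"
  have tri: "spectral_norm X \<le> spectral_norm Y + spectral_norm (X - Y)" for X Y :: "real^'n^'m"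
  proof -
    have "(\<lambda>x. X *v x) = (\<lambda>x. Y *v x + (X - Y) *v x)"
      by (simp add: matrix_vector_mult_diff_rdistrib)
    then show ?thesis
      using onorm_triangle[OF matrix_vector_mul_bounded_linear[of Y] matrix_vector_mul_bounded_linear[of "X - Y"]]
      unfolding spectral_norm_def by metis
  qed
  have bound: "norm (spectral_norm X - spectral_norm A) \<le> (\<Sum>i\<in>UNIV. \<Sum>j\<in>UNIV. \<bar>(X - A) $ i $ j\<bar>)" for X
  proof -
    have "spectral_norm (A - X) = spectral_norm (X - A)"
      using spectral_norm_uminus[of "X - A"] by (simp only: minus_diff_eq)
    then have "\<bar>spectral_norm X - spectral_norm A\<bar> \<le> spectral_norm (X - A)"
      using tri[of X A] tri[of A X] by linarith
    then show ?thesis using spectral_norm_le_sum_entries[of "X - A"] unfolding real_norm_def by linarith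
  qed
  have "((\<lambda>X. \<Sum>i\<in>UNIV. \<Sum>j\<in>UNIV. \<bar>(X - A) $ i $ j\<bar>)
      \<longlongrightarrow> (\<Sum>i\<in>(UNIV::'m set). \<Sum>j\<in>(UNIV::'n set). \<bar>(A - A) $ i $ j\<bar>)) (at A)"
    by (intro tendsto_sum tendsto_rabs tendsto_vec_nth tendsto_diff tendsto_ident_at tendsto_const)
  then have lim: "((\<lambda>X. \<Sum>i\<in>UNIV. \<Sum>j\<in>UNIV. \<bar>(X - A) $ i $ j\<bar>) \<longlongrightarrow> 0) (at A)"
    by (simp only: diff_self zero_index abs_zero sum.neutral_const)
  have "((\<lambda>X. spectral_norm X - spectral_norm A) \<longlongrightarrow> 0) (at A)"
    by (rule Lim_null_comparison[OF always_eventually lim]) (use bound in blast)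
  then show "isCont spectral_norm A" unfolding isCont_def by (rule LIM_zero_cancel)
qed

section \<open>The residual as a moving average of the noise\<close>

lemma matpow_Suc: "matpow G (Suc k) = G ** matpow G k"
  by (simp add: matpow_def)

lemma matpow_0: "matpow G 0 = mat 1"
  by (simp add: matpow_def)

lemma linear_recurrence_solution:
  fixes x :: "nat \<Rightarrow> real^'n"
  assumes "x 0 = 0" and "\<And>n. x (Suc n) = G *v x n - q n"
  shows "x n = - (\<Sum>k<n. matpow G (n - 1 - k) *v q k)"
proof (induction n)
  case (Suc n)
  have "G *v (\<Sum>k<n. matpow G (n - 1 - k) *v q k) = (\<Sum>k<n. matpow G (n - k) *v q k)"
  proof -
    have "G *v (\<Sum>k<n. matpow G (n - 1 - k) *v q k) = (\<Sum>k<n. matpow G (Suc (n - 1 - k)) *v q k)"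
      by (simp add: linear_sum[OF matrix_vector_mul_linear] matrix_vector_mul_assoc matpow_Suc)
    also have "\<dots> = (\<Sum>k<n. matpow G (n - k) *v q k)"
      by (intro sum.cong refl) (auto dest!: less_imp_Suc_add)
    finally show ?thesis .
  qed
  moreover have "G *v (- y) = - (G *v y)" for y
    using matrix_vector_mult_diff_distrib[of G 0 y] by simp
  ultimately show ?case by (simp add: assms Suc matpow_0)
qed (simp add: assms)

text \<open>The effect, up to sign, on the residual of process noise and of measurement noise \<open>l\<close> steps
  earlier.  Lag \<open>0\<close> stands for the direct measurement error \<open>- z n\<close>, in which process noise takes
  no part.\<close>

definition noise_response :: "real^'p^'p \<Rightarrow> real^'p^'m \<Rightarrow> nat \<Rightarrow> real^'p^'m" where
  "noise_response G C l = (case l of 0 \<Rightarrow> 0 | Suc k \<Rightarrow> C ** matpow G k)"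

definition measurement_response :: "real^'p^'p \<Rightarrow> real^'p^'m \<Rightarrow> real^'m^'p \<Rightarrow> nat \<Rightarrow> real^'m^'m" where
  "measurement_response G C L l = (case l of 0 \<Rightarrow> mat 1 | Suc k \<Rightarrow> C ** matpow G k ** L)"

lemma uminus_matrix_vector_mult: "(- X) *v y = - (X *v y)" for X :: "real^'n^'m"
  using matrix_vector_mult_diff_rdistrib[of 0 X] by simp

lemma matrix_mult_uminus_right: "C ** (- X) = - (C ** X)" for C :: "real^'n^'m" and X :: "real^'k^'n"
proof -
  have "C *v (- y) = - (C *v y)" for y by (rule linear_neg[OF matrix_vector_mul_linear])
  then show ?thesis
    by (simp add: matrix_eq uminus_matrix_vector_mult flip: matrix_vector_mul_assoc)
qed

lemma matrix_mult_Dbar: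
  "k < n \<Longrightarrow> C ** Dbar A C L n k = - noise_response (A + L ** C) C (n - k)"
  by (auto dest!: less_imp_Suc_add simp: Dbar_def noise_response_def matrix_mult_uminus_right)

lemma matrix_mult_Lbar:
  "k < n \<Longrightarrow> C ** Lbar A C L n k = - measurement_response (A + L ** C) C L (n - k)"
  by (auto dest!: less_imp_Suc_add
      simp: Lbar_def measurement_response_def matrix_mult_uminus_right matrix_mul_assoc)

lemma sum_atMost_lag: "(\<Sum>l\<le>n. h l) = h 0 + (\<Sum>k<n. h (n - k))" for h :: "nat \<Rightarrow> 'c::comm_monoid_add"
proof -
  have "(\<Sum>k<n. h (n - k)) = (\<Sum>k<n. h (Suc k))"
    by (subst sum.nat_diff_reindex[symmetric]) (auto intro!: sum.cong simp: Suc_diff_Suc)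
  then show ?thesis by (simp add: sum.atMost_shift)
qed

lemma free_residual_moving_average:
  "C *v free_error A C L w z n \<omega> - z n \<omega>
    = (\<Sum>l\<le>n. - (noise_response (A + L ** C) C l *v w (n - l) \<omega>
                + measurement_response (A + L ** C) C L l *v z (n - l) \<omega>))"
proof -
  let ?h = "\<lambda>l. - (noise_response (A + L ** C) C l *v w (n - l) \<omega>
                + measurement_response (A + L ** C) C L l *v z (n - l) \<omega>)"
  have "C *v free_error A C L w z n \<omega> = (\<Sum>k<n. C ** Dbar A C L n k *v w k \<omega> + C ** Lbar A C L n k *v z k \<omega>)"
    by (simp add: free_error_def linear_sum[OF matrix_vector_mul_linear]
        matrix_vector_right_distrib matrix_vector_mul_assoc)
  also have "\<dots> = (\<Sum>k<n. ?h (n - k))"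
    by (intro sum.cong) (auto simp: matrix_mult_Dbar matrix_mult_Lbar uminus_matrix_vector_mult)
  finally show ?thesis
    unfolding sum_atMost_lag[of ?h] by (simp add: noise_response_def measurement_response_def)
qed

text \<open>Thus \<open>Kbar\<close> is the partial sum of the bounds for the single lags: for nonnegative noise bounds
  it increases with \<open>n\<close>, and its boundedness is the summability that the moving average
  estimate requires.\<close>

lemma Kbar_eq_sum_responses:
  "Kbar A C L Kw Kz n
    = (\<Sum>l\<le>n. spectral_norm (noise_response (A + L ** C) C l) * Kw
             + spectral_norm (measurement_response (A + L ** C) C L l) * Kz)"
proof -
  have "spectral_norm (mat 1 :: real^'b^'b) = 1" "spectral_norm (0 :: real^'a^'b) = 0"
    using onorm_id[where 'a="real^'b"] by (simp_all add: spectral_norm_def onorm_zero)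
  then show ?thesis
    by (simp add: Kbar_def sum_atMost_lag noise_response_def[of _ _ 0] measurement_response_def[of _ _ _ 0]
        matrix_mult_Dbar matrix_mult_Lbar spectral_norm_uminus)
qed

text \<open>By monotonicity the average of \<open>f ^ 4\<close> over \<open>{0..<2 * n'}\<close> is at least half of \<open>f n ^ 4\<close> for
  \<open>n < n'\<close>, since the second half of the window lies beyond \<open>n\<close>.  Applied
  to \<open>Kbar\<close>, this makes the bounds for the single lags summable.\<close>

lemma mono_bounded_if_c1_linear:
  assumes mono: "mono f" and nn: "\<And>n. 0 \<le> f n"
    and c1: "\<And>N. N \<ge> 1 \<Longrightarrow> c1 f N \<le> real N * S"
  shows "f n \<le> 1 + S"
proof -
  define n' where "n' = Suc n"
  have "real n' * f n ^ 4 = (\<Sum>k=n'..<2 * n'. f n ^ 4)" by simp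
  also have "\<dots> \<le> (\<Sum>k=n'..<2 * n'. f k ^ 4)"
    using nn by (intro sum_mono power_mono monoD[OF mono]) (auto simp: n'_def)
  also have "\<dots> \<le> (\<Sum>k<2 * n'. f k ^ 4)" by (intro sum_mono2) auto
  also have "\<dots> \<le> real (2 * n') * S / 8" using c1[of "2 * n'"] by (simp add: c1_def n'_def)
  also have "\<dots> = real n' * (S / 4)" by simp
  finally have "real n' * f n ^ 4 \<le> real n' * (S / 4)" .
  then have 4: "f n ^ 4 \<le> S / 4" by (simp add: n'_def)
  then have "0 \<le> S" using zero_le_power[OF nn, of n 4] by linarith
  show ?thesis
  proof (cases "f n \<le> 1")
    case False
    then have "f n ^ 1 \<le> f n ^ 4" by (intro power_increasing) auto
    then show ?thesis using 4 \<open>0 \<le> S\<close> by simp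
  qed (use \<open>0 \<le> S\<close> in simp)
qed

section \<open>The tests below the threshold\<close>

text \<open>The spectral norm is at most the sum of the absolute entries, so it suffices to allot each
  entry an equal share of the threshold, half of it for the main term and half of it for the
  constant \<open>Q\<close>, which is eventually dominated.\<close>

lemma eventually_spectral_norm_le_threshold:
  fixes \<Psi> :: "nat \<Rightarrow> real^'b^'a"
  assumes S: "0 < S" and \<rho>: "0 < \<rho>"
    and c: "c = sqrt ((1 + \<rho>) * S) / (2 * real CARD('a) * real CARD('b))"
    and \<Psi>: "\<And>i j. \<forall>\<^sub>F N in sequentially. \<bar>\<Psi> N $ i $ j\<bar> \<le> c * sqrt (real N * ln (real N)) + Q"
  shows "\<forall>\<^sub>F N in sequentially. spectral_norm ((1 / real N) *\<^sub>R \<Psi> N) \<le> threshold \<rho> S N"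
proof -
  have c0: "c > 0" using S \<rho> by (simp add: c)
  have "filterlim (\<lambda>N. c * sqrt (real N * ln (real N))) at_top sequentially"
    using c0 by (intro filterlim_tendsto_pos_mult_at_top[OF tendsto_const] filterlim_compose[OF sqrt_at_top]
        filterlim_at_top_mult_at_top filterlim_real_sequentially
        filterlim_compose[OF ln_at_top filterlim_real_sequentially])
  then have Q: "\<forall>\<^sub>F N in sequentially. Q \<le> c * sqrt (real N * ln (real N))"
    unfolding filterlim_at_top by (rule spec)
  have all: "\<forall>\<^sub>F N in sequentially. \<forall>i j. \<bar>\<Psi> N $ i $ j\<bar> \<le> c * sqrt (real N * ln (real N)) + Q"
    by (intro eventually_all_finite \<Psi>)
  from all Q eventually_gt_at_top[of 0] show ?thesis
  proof eventually_elim
    case (elim N)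
    have N: "real N > 0" using elim by simp
    have "spectral_norm ((1 / real N) *\<^sub>R \<Psi> N) \<le> (\<Sum>i\<in>UNIV. \<Sum>j\<in>UNIV. \<bar>((1 / real N) *\<^sub>R \<Psi> N) $ i $ j\<bar>)"
      by (rule spectral_norm_le_sum_entries)
    also have "\<dots> \<le> (\<Sum>i\<in>(UNIV::'a set). \<Sum>j\<in>(UNIV::'b set). 2 * c * sqrt (real N * ln (real N)) / real N)"
    proof (intro sum_mono)
      fix i j
      have "\<bar>\<Psi> N $ i $ j\<bar> \<le> 2 * c * sqrt (real N * ln (real N))" using elim(1)[rule_format, of i j] elim(2) by linarith
      then show "\<bar>((1 / real N) *\<^sub>R \<Psi> N) $ i $ j\<bar> \<le> 2 * c * sqrt (real N * ln (real N)) / real N"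
        using N by (simp add: abs_mult divide_right_mono)
    qed
    also have "\<dots> = sqrt ((1 + \<rho>) * S) * (sqrt (real N * ln (real N)) / real N)"
      by (simp add: c)
    also have "sqrt (real N * ln (real N)) / real N = sqrt (ln (real N) / real N)"
    proof -
      have "sqrt (real N * ln (real N)) / real N = sqrt (real N) * sqrt (ln (real N)) / (sqrt (real N) * sqrt (real N))"
        using N by (simp add: real_sqrt_mult)
      also have "\<dots> = sqrt (ln (real N)) / sqrt (real N)"
        using N by (intro nonzero_mult_divide_mult_cancel_left) simp
      finally show ?thesis by (simp add: real_sqrt_divide)
    qed
    also have "sqrt ((1 + \<rho>) * S) * sqrt (ln (real N) / real N) = threshold \<rho> S N"
      by (simp add: threshold_def flip: real_sqrt_mult)
    finally show ?case .
  qed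
qed

lemma borel_measurable_matrix_vector_mult [measurable (raw)]:
  fixes X :: "real^'n^'m"
  shows "f \<in> borel_measurable M \<Longrightarrow> (\<lambda>\<omega>. X *v f \<omega>) \<in> borel_measurable M"
  by (rule measurable_compose[OF _ borel_measurable_continuous_onI])
    (auto intro: linear_continuous_on matrix_vector_mul_bounded_linear)

lemma borel_measurable_vec_nth' [measurable (raw)]:
  fixes f :: "'w \<Rightarrow> real^'n"
  shows "f \<in> borel_measurable M \<Longrightarrow> (\<lambda>\<omega>. f \<omega> $ i) \<in> borel_measurable M"
  by (rule measurable_compose[OF _ borel_measurable_continuous_onI])
    (auto intro: linear_continuous_on bounded_linear_vec_nth)

lemma borel_measurable_outer_prod [measurable (raw)]:
  fixes f :: "'w \<Rightarrow> real^'m" and g :: "'w \<Rightarrow> real^'n"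
  assumes "f \<in> borel_measurable M" "g \<in> borel_measurable M"
  shows "(\<lambda>\<omega>. outer_prod (f \<omega>) (g \<omega>)) \<in> borel_measurable M"
proof (rule borel_measurable_continuous_Pair[OF assms])
  show "continuous_on UNIV (\<lambda>p. outer_prod (fst p) (snd p) :: real^'n^'m)"
    unfolding outer_prod_def by (intro continuous_intros)
qed

section \<open>The residual under attack\<close>

text \<open>Superposition: the error recursion is linear and starts at \<open>0\<close>.\<close>

lemma attacked_residual:
  fixes \<delta> :: "nat \<Rightarrow> real^'p" and C :: "real^'p^'m" and L :: "real^'m^'p"
  assumes "\<delta> 0 = 0"
    and "\<And>n. \<delta> (Suc n) = (A + L ** C) *v \<delta> n - w n \<omega> - L *v z n \<omega> - L *v v n \<omega>"
  shows "C *v \<delta> n - z n \<omega> - v n \<omega>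
    = (C *v free_error A C L w z n \<omega> - z n \<omega>) + residual_attack A C L v n \<omega>"
proof -
  let ?G = "A + L ** C"
  have "\<delta> n = - (\<Sum>k<n. matpow ?G (n - 1 - k) *v (w k \<omega> + L *v z k \<omega> + L *v v k \<omega>))"
    using assms by (intro linear_recurrence_solution) (simp_all add: algebra_simps)
  also have "\<dots> = free_error A C L w z n \<omega> + (\<Sum>k<n. Lbar A C L n k *v v k \<omega>)"
    by (simp add: free_error_def Dbar_def Lbar_def uminus_matrix_vector_mult matrix_vector_right_distrib
        sum_negf sum.distrib sum_subtractf flip: matrix_vector_mul_assoc)
  finally show ?thesis
    by (simp add: residual_attack_def matrix_vector_right_distrib)
qed

lemma (in prob_space) expectation_matrix_vector_nth:
  fixes X :: "'a \<Rightarrow> real^'n" and B :: "real^'n^'m"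
  assumes "integrable M X"
  shows "expectation (\<lambda>\<omega>. (B *v X \<omega>) $ i) = (B *v expectation X) $ i"
    and "integrable M (\<lambda>\<omega>. (B *v X \<omega>) $ i)"
proof -
  have bl: "bounded_linear (\<lambda>x. (B *v x) $ i)"
    by (rule bounded_linear_compose[OF bounded_linear_vec_nth matrix_vector_mul_bounded_linear])
  show "expectation (\<lambda>\<omega>. (B *v X \<omega>) $ i) = (B *v expectation X) $ i"
    by (rule integral_bounded_linear[OF bl assms])
  show "integrable M (\<lambda>\<omega>. (B *v X \<omega>) $ i)"
    by (rule integrable_bounded_linear[OF bl assms])
qed

lemma abs_matrix_vector_nth_le:
  assumes "norm x \<le> c"
  shows "\<bar>(B *v x) $ i\<bar> \<le> spectral_norm B * c"
  by (intro order_trans[OF component_le_norm_cart] order_trans[OF norm_matrix_vector_le]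
      mult_left_mono assms spectral_norm_nonneg)

text \<open>Both tests are products of moving averages of the same independent family
  \<open>\<xi> n = (e n, (w n, z n))\<close>: a component of the residual \<open>r n\<close> with another one, or with a component
  of the watermark \<open>e n\<close>, which is a moving average with lag \<open>0\<close> only.  In the second case the
  centring term vanishes, because the watermark is independent of the noise.\<close>

lemma (in prob_space) free_residual_tests_concentrate:
  fixes A :: "real^'p^'p" and C :: "real^'p^'m" and L :: "real^'m^'p"
    and w :: "nat \<Rightarrow> 'a \<Rightarrow> real^'p" and z :: "nat \<Rightarrow> 'a \<Rightarrow> real^'m" and e :: "nat \<Rightarrow> 'a \<Rightarrow> real^'q"
  defines "r \<equiv> \<lambda>n \<omega>. C *v free_error A C L w z n \<omega> - z n \<omega>"
  assumes iw: "indep_vars (\<lambda>_. borel) w UNIV" and iz: "indep_vars (\<lambda>_. borel) z UNIV"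
    and ie: "indep_vars (\<lambda>_. borel) e UNIV"
    and wz: "indep_random M (Pi\<^sub>M UNIV (\<lambda>_. borel)) (\<lambda>\<omega> n. w n \<omega>) (Pi\<^sub>M UNIV (\<lambda>_. borel)) (\<lambda>\<omega> n. z n \<omega>)"
    and ewz: "indep_random M (Pi\<^sub>M UNIV (\<lambda>_. borel)) (\<lambda>\<omega> n. e n \<omega>)
      (Pi\<^sub>M UNIV (\<lambda>_. borel \<Otimes>\<^sub>M borel)) (\<lambda>\<omega> n. (w n \<omega>, z n \<omega>))"
    and w0: "\<And>n. expectation (w n) = 0" and z0: "\<And>n. expectation (z n) = 0"
    and e0: "\<And>n. expectation (e n) = 0"
    and bw: "\<And>n. AE \<omega> in M. norm (w n \<omega>) \<le> Kw" and bz: "\<And>n. AE \<omega> in M. norm (z n \<omega>) \<le> Kz"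
    and be: "\<And>n. AE \<omega> in M. norm (e n \<omega>) \<le> Ke"
    and nn: "0 \<le> Kw" "0 \<le> Kz" "0 \<le> Ke" and H: "\<And>n. Kbar A C L Kw Kz n \<le> H"
    and c: "0 < c"
  shows "AE \<omega> in M. \<forall>\<^sub>F N in sequentially.
      \<bar>\<Sum>n<N. r n \<omega> $ i * r n \<omega> $ j - free_second_moment M A C L w z n $ i $ j\<bar>
        \<le> c * sqrt (real N * ln (real N))" (is ?covariance)
    and "AE \<omega> in M. \<forall>\<^sub>F N in sequentially.
      \<bar>\<Sum>n<N. r n \<omega> $ i * e n \<omega> $ k\<bar> \<le> c * sqrt (real N * ln (real N))" (is ?watermark)
    and "AE \<omega> in M. \<bar>r n \<omega> $ i\<bar> \<le> H" (is ?bound)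
proof -
  let ?P = "noise_response (A + L ** C) C" and ?Q = "measurement_response (A + L ** C) C L"
  define \<xi> where "\<xi> n \<omega> = (e n \<omega>, (w n \<omega>, z n \<omega>))" for n \<omega>
  define f where "f i l x = (case x of (_, (a, b)) \<Rightarrow> - ((?P l *v a) $ i) - (?Q l *v b) $ i)"
    for i :: 'm and l and x :: "(real^'q) \<times> (real^'p) \<times> (real^'m)"
  define g where "g k l x = (if l = 0 then fst x $ k else 0)"
    for k :: 'q and l :: nat and x :: "(real^'q) \<times> (real^'p) \<times> (real^'m)"
  define a where "a l = spectral_norm (?P l) * Kw + spectral_norm (?Q l) * Kz" for l
  define b where "b l = (if l = 0 then Ke else 0)" for l :: nat
  let ?N = "borel \<Otimes>\<^sub>M (borel \<Otimes>\<^sub>M borel) :: ((real^'q) \<times> (real^'p) \<times> (real^'m)) measure"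
  have ind: "indep_vars (\<lambda>_. ?N) \<xi> UNIV"
    unfolding \<xi>_def by (intro indep_vars_Pair ie iw iz wz ewz)
  have rw [measurable]: "w n \<in> borel_measurable M" and rz [measurable]: "z n \<in> borel_measurable M"
    and re [measurable]: "e n \<in> borel_measurable M" for n
    using iw iz ie by (simp_all add: indep_vars_def)
  have int_w: "integrable M (w n)" and int_z: "integrable M (z n)" and int_e: "integrable M (e n)" for n
    using bw[of n] bz[of n] be[of n] by (auto intro: integrable_const_bound)
  have f_meas [measurable]: "f i l \<in> borel_measurable ?N" for i l unfolding f_def by measurable
  have g_meas [measurable]: "g k l \<in> borel_measurable ?N" for k l unfolding g_def by measurable
  have f_bd: "AE \<omega> in M. \<bar>f i l (\<xi> n \<omega>)\<bar> \<le> a l" for i l n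
    using bw[of n] bz[of n]
  proof eventually_elim
    case (elim \<omega>)
    from abs_matrix_vector_nth_le[OF elim(1), of "?P l" i] abs_matrix_vector_nth_le[OF elim(2), of "?Q l" i]
    show ?case by (simp add: f_def \<xi>_def a_def)
  qed
  have g_bd: "AE \<omega> in M. \<bar>g k l (\<xi> n \<omega>)\<bar> \<le> b l" for k l n
    using be[of n]
  proof eventually_elim
    case (elim \<omega>)
    then show ?case using order_trans[OF component_le_norm_cart elim] by (simp add: g_def \<xi>_def b_def)
  qed
  have f_0: "expectation (\<lambda>\<omega>. f i l (\<xi> n \<omega>)) = 0" for i l n
    using expectation_matrix_vector_nth[OF int_w[of n], of "?P l" i]
      expectation_matrix_vector_nth[OF int_z[of n], of "?Q l" i]
    by (simp add: f_def \<xi>_def w0 z0)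
  have g_0: "expectation (\<lambda>\<omega>. g k l (\<xi> n \<omega>)) = 0" for k l n
    using expectation_matrix_vector_nth(1)[OF int_e[of n], of "mat 1" k]
    by (cases "l = 0") (simp_all add: g_def \<xi>_def e0)
  have a_nn: "0 \<le> a l" and b_nn: "0 \<le> b l" for l
    using nn by (auto simp: a_def b_def spectral_norm_nonneg)
  have a_sum: "(\<Sum>l\<le>n. a l) \<le> H" for n
    using H[of n] by (simp add: a_def Kbar_eq_sum_responses)
  have b_sum: "(\<Sum>l\<le>n. b l) \<le> Ke" for n
    by (simp add: b_def sum.delta)
  have r_eq: "(\<Sum>l\<le>n. f i l (\<xi> (n - l) \<omega>)) = r n \<omega> $ i" for i n \<omega>
    unfolding r_def free_residual_moving_average by (simp add: f_def \<xi>_def sum_component)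
  have e_eq: "(\<Sum>l\<le>n. g k l (\<xi> (n - l) \<omega>)) = e n \<omega> $ k" for k n \<omega>
    unfolding sum_atMost_lag by (simp add: g_def \<xi>_def)
  have r_bd: "AE \<omega> in M. \<bar>r n \<omega> $ i\<bar> \<le> H" for i n
  proof -
    have "AE \<omega> in M. \<forall>l\<in>{..n}. \<bar>f i l (\<xi> (n - l) \<omega>)\<bar> \<le> a l"
      using f_bd by (intro AE_finite_allI) auto
    then show ?thesis
    proof eventually_elim
      case (elim \<omega>)
      have "\<bar>r n \<omega> $ i\<bar> \<le> (\<Sum>l\<le>n. a l)"
        unfolding r_eq[symmetric] using elim by (intro order_trans[OF sum_abs] sum_mono) auto
      then show ?case using a_sum[of n] by linarith
    qed
  qed
  then show ?bound .
  have r_meas [measurable]: "(\<lambda>\<omega>. r n \<omega> $ i) \<in> borel_measurable M" for i n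
    unfolding r_def free_error_def by measurable
  have r_eb: "ess_bounded M (\<lambda>\<omega>. r n \<omega> $ i)" for i n
    by (rule ess_boundedI[OF r_meas r_bd])
  have e_eb: "ess_bounded M (\<lambda>\<omega>. e n \<omega> $ k)" for k n
    using g_bd[of k 0 n] by (intro ess_boundedI[where c=Ke]) (auto simp: g_def \<xi>_def b_def)
  have R: "free_second_moment M A C L w z n $ i $ j = expectation (\<lambda>\<omega>. r n \<omega> $ i * r n \<omega> $ j)" for n
  proof -
    have le: "AE \<omega> in M. norm (outer_prod (r n \<omega>) (r n \<omega>)) \<le> (\<Sum>i\<in>(UNIV::'m set). \<Sum>j\<in>(UNIV::'m set). H * H)"
    proof -
      have "AE \<omega> in M. \<forall>i. \<bar>r n \<omega> $ i\<bar> \<le> H"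
        unfolding AE_all_countable using r_bd by blast
      then show ?thesis
      proof eventually_elim
        case (elim \<omega>)
        have "norm (outer_prod (r n \<omega>) (r n \<omega>)) \<le> (\<Sum>i\<in>UNIV. norm (outer_prod (r n \<omega>) (r n \<omega>) $ i))"
          by (subst norm_vec_def) (rule L2_set_le_sum, simp)
        also have "\<dots> \<le> (\<Sum>i\<in>(UNIV::'m set). \<Sum>j\<in>(UNIV::'m set). H * H)"
        proof (intro sum_mono)
          fix i
          have "norm (outer_prod (r n \<omega>) (r n \<omega>) $ i) \<le> (\<Sum>j\<in>UNIV. \<bar>outer_prod (r n \<omega>) (r n \<omega>) $ i $ j\<bar>)"
            by (rule norm_le_l1_cart)
          also have "\<dots> \<le> (\<Sum>j\<in>(UNIV::'m set). H * H)"
            using elim by (intro sum_mono) (simp add: outer_prod_def abs_mult mult_mono')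
          finally show "norm (outer_prod (r n \<omega>) (r n \<omega>) $ i) \<le> (\<Sum>j\<in>(UNIV::'m set). H * H)" .
        qed
        finally show ?case .
      qed
    qed
    have "(\<lambda>\<omega>. outer_prod (r n \<omega>) (r n \<omega>)) \<in> borel_measurable M"
      unfolding r_def free_error_def by measurable
    then have int: "integrable M (\<lambda>\<omega>. outer_prod (r n \<omega>) (r n \<omega>))"
      using le by (rule integrable_const_bound[rotated])
    have bl: "bounded_linear (\<lambda>X :: real^'m^'m. X $ i $ j)"
      by (rule bounded_linear_compose[OF bounded_linear_vec_nth bounded_linear_vec_nth])
    show ?thesis
      using integral_bounded_linear[OF bl int]
      by (simp add: free_second_moment_def r_def outer_prod_def)
  qed
  show ?covariance
    using moving_average_product_deviation[OF ind f_meas[of i] f_meas[of j] f_bd f_bd f_0 f_0 a_nn a_nn a_sum a_sum c]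
    unfolding r_eq R .
  have re0: "expectation (\<lambda>\<omega>. r n \<omega> $ i * e n \<omega> $ k) = 0" for n
  proof -
    let ?E = "\<lambda>x. (x n :: real^'q) $ k" and ?W = "\<lambda>y. \<Sum>l\<le>n. f i l (0, y (n - l))"
    have fy: "f i l (0, (w m \<omega>, z m \<omega>)) = f i l (\<xi> m \<omega>)" for l m \<omega> by (simp add: f_def \<xi>_def)
    have "expectation (\<lambda>\<omega>. ?E (\<lambda>n. e n \<omega>) * ?W (\<lambda>n. (w n \<omega>, z n \<omega>)))
      = expectation (\<lambda>\<omega>. ?E (\<lambda>n. e n \<omega>)) * expectation (\<lambda>\<omega>. ?W (\<lambda>n. (w n \<omega>, z n \<omega>)))"
    proof (rule indep_random_expectation_mult[OF ewz])
      show "?W \<in> borel_measurable (Pi\<^sub>M UNIV (\<lambda>_. borel \<Otimes>\<^sub>M borel))" by measurable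
      show "?E \<in> borel_measurable (Pi\<^sub>M UNIV (\<lambda>_. borel))"
        by measurable
    qed (use e_eb r_eb in \<open>simp_all add: fy r_eq\<close>)
    then have "expectation (\<lambda>\<omega>. e n \<omega> $ k * r n \<omega> $ i)
      = expectation (\<lambda>\<omega>. e n \<omega> $ k) * expectation (\<lambda>\<omega>. r n \<omega> $ i)"
      by (simp only: fy r_eq)
    moreover have "expectation (\<lambda>\<omega>. e n \<omega> $ k) = 0"
      using g_0[of k 0 n] by (simp add: g_def \<xi>_def)
    ultimately show ?thesis by (simp add: mult.commute)
  qed
  show ?watermark
    using moving_average_product_deviation[OF ind f_meas[of i] g_meas[of k] f_bd g_bd f_0 g_0 a_nn b_nn a_sum b_sum c]
    unfolding r_eq e_eq re0 diff_0_right .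
qed

section \<open>Finitely many detections\<close>

text \<open>The watermark enters as \<open>e' n = e (n - k' - 1)\<close>, which is an independent family indexed by
  the natural numbers, as the estimate of the tests without attack requires.\<close>

theorem theorem6:
  fixes M :: "'w measure"
    and A :: "real^'p^'p" and B :: "real^'q^'p" and K :: "real^'p^'q"
    and C\<^sub>1 C\<^sub>2 :: "real^'p^'m" and L\<^sub>1 L\<^sub>2 :: "real^'m^'p"
    and x x' xhat w :: "nat \<Rightarrow> 'w \<Rightarrow> real^'p"
    and u :: "nat \<Rightarrow> 'w \<Rightarrow> real^'q"
    and y \<zeta> \<eta> v d :: "nat \<Rightarrow> 'w \<Rightarrow> real^'m"
    and e :: "int \<Rightarrow> 'w \<Rightarrow> real^'q"
    and \<alpha> :: "int \<Rightarrow> 'w \<Rightarrow> real"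
    and \<Sigma>w :: "real^'p^'p" and \<Sigma>\<zeta> \<Sigma>\<eta> :: "real^'m^'m" and \<Sigma>e :: "real^'q^'q"
    and Kw Kz Ke S \<rho> :: real
    and P :: "real^('p + 'p)^('p + 'p)"
    and k' \<tau> :: nat
    and R :: "nat \<Rightarrow> real^'m^'m"
    and \<Phi>\<^sub>1 :: "nat \<Rightarrow> 'w \<Rightarrow> real^'m^'m" and \<Phi>\<^sub>2 :: "nat \<Rightarrow> 'w \<Rightarrow> real^'q^'m"
    and E :: "nat \<Rightarrow> 'w set"
  assumes prob: "prob_space M"
    \<comment> \<open>plant and gains\<close>
    and stab: "stabilizable A B"
    and det1: "detectable A C\<^sub>1" and det2: "detectable A C\<^sub>2"
    and schurK: "schur_stable (A + B ** K)"
    and schurL1: "schur_stable (A + L\<^sub>1 ** C\<^sub>1)"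
    and schurL2: "schur_stable (A + L\<^sub>2 ** C\<^sub>2)"
    \<comment> \<open>noise and watermark\<close>
    and iid_w: "iid_zero_mean M UNIV w \<Sigma>w"
    and iid_zeta: "iid_zero_mean M UNIV \<zeta> \<Sigma>\<zeta>"
    and iid_eta: "iid_zero_mean M UNIV \<eta> \<Sigma>\<eta>"
    and iid_e: "iid_zero_mean M {- int k' - 1..} e \<Sigma>e"
    and cov_le: "\<Sigma>\<zeta> \<preceq> \<Sigma>\<eta>"
    and indep_w: "indep_random M
        (Pi\<^sub>M UNIV (\<lambda>_. borel)) (\<lambda>\<omega> (n::nat). w n \<omega>)
        (Pi\<^sub>M UNIV (\<lambda>_. borel)) (\<lambda>\<omega> (n::nat). (\<zeta> n \<omega>, \<eta> n \<omega>))"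
    and indep_e: "indep_random M
        (Pi\<^sub>M {- int k' - 1..} (\<lambda>_. borel)) (\<lambda>\<omega>. \<lambda>j\<in>{- int k' - 1..}. e j \<omega>)
        (Pi\<^sub>M UNIV (\<lambda>_. borel)) (\<lambda>\<omega> (n::nat). (w n \<omega>, \<zeta> n \<omega>, \<eta> n \<omega>))"
    and bound_w: "AE \<omega> in M. \<forall>n. norm (w n \<omega>) \<le> Kw"
    and bound_z: "AE \<omega> in M. \<forall>n. norm (\<zeta> n \<omega>) \<le> Kz \<and> norm (\<eta> n \<omega>) \<le> Kz"
    and bound_e: "AE \<omega> in M. \<forall>j\<ge>- int k' - 1. norm (e j \<omega>) \<le> Ke"
    \<comment> \<open>closed loop under the attack \<open>v\<close>\<close>
    and meas_v: "\<And>n. v n \<in> borel_measurable M"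
    and alpha01: "\<And>j \<omega>. \<omega> \<in> space M \<Longrightarrow> \<alpha> j \<omega> \<in> {0, 1}"
    and plant: "\<And>n \<omega>. \<omega> \<in> space M \<Longrightarrow> x (Suc n) \<omega> = A *v x n \<omega> + B *v u n \<omega> + w n \<omega>"
    and measurement: "\<And>n \<omega>. \<omega> \<in> space M \<Longrightarrow>
        y n \<omega> = switched (\<alpha> (int n) \<omega>) C\<^sub>1 C\<^sub>2 *v x n \<omega>
              + switched (\<alpha> (int n) \<omega>) (\<zeta> n \<omega>) (\<eta> n \<omega>) + \<alpha> (int n) \<omega> *\<^sub>R v n \<omega>"
    and control: "\<And>n \<omega>. \<omega> \<in> space M \<Longrightarrow> u n \<omega> = K *v x' n \<omega> + e (int n) \<omega>"
    and observer1: "\<And>n \<omega>. \<omega> \<in> space M \<Longrightarrow>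
        x' (Suc n) \<omega> =
          (A + B ** K + switched (\<alpha> (int n) \<omega>) L\<^sub>1 L\<^sub>2 ** switched (\<alpha> (int n) \<omega>) C\<^sub>1 C\<^sub>2) *v x' n \<omega>
          + B *v e (int n) \<omega> - switched (\<alpha> (int n) \<omega>) L\<^sub>1 L\<^sub>2 *v y n \<omega>"
    \<comment> \<open>second observer\<close>
    and observer2_init: "\<And>\<omega>. \<omega> \<in> space M \<Longrightarrow> xhat 0 \<omega> - x 0 \<omega> = 0"
    and observer2: "\<And>n \<omega>. \<omega> \<in> space M \<Longrightarrow>
        xhat (Suc n) \<omega> - x (Suc n) \<omega> =
          (A + L\<^sub>1 ** C\<^sub>1) *v (xhat n \<omega> - x n \<omega>) - w n \<omega> - L\<^sub>1 *v \<zeta> n \<omega> - L\<^sub>1 *v v n \<omega>"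
    and residual: "\<And>n \<omega>. \<omega> \<in> space M \<Longrightarrow>
        d n \<omega> = C\<^sub>1 *v xhat n \<omega> - (C\<^sub>1 *v x n \<omega> + \<zeta> n \<omega> + v n \<omega>)"
    \<comment> \<open>tests\<close>
    and k'_ex: "\<exists>k. C\<^sub>1 ** matpow (A + B ** K) k ** B \<noteq> 0"
    and k'_def: "k' = (LEAST k. C\<^sub>1 ** matpow (A + B ** K) k ** B \<noteq> 0)"
    and R_def: "R = free_second_moment M A C\<^sub>1 L\<^sub>1 w \<zeta>"
    and Phi1_def: "\<Phi>\<^sub>1 = covariance_test R d"
    and Phi2_def: "\<Phi>\<^sub>2 = watermark_test k' d e"
    and S_pos: "S > 0"
    and S_bound: "\<And>N. N \<ge> 1 \<Longrightarrow>
        max (c1 (Kbar A C\<^sub>1 L\<^sub>1 Kw Kz) N)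
          (max (c2 (Kbar A C\<^sub>1 L\<^sub>1 Kw Kz) R Ke \<Sigma>e N) (c3 M e Ke \<Sigma>e N)) \<le> real N * S"
    and rho_pos: "\<rho> > 0"
    and E_def: "E = detection_event M \<Phi>\<^sub>1 \<Phi>\<^sub>2 (threshold \<rho> S)"
    \<comment> \<open>switching rule\<close>
    and P_eq: "closed_loop_matrix A B K C\<^sub>1 C\<^sub>2 L\<^sub>1 L\<^sub>2 1 ** P
        ** transpose (closed_loop_matrix A B K C\<^sub>1 C\<^sub>2 L\<^sub>1 L\<^sub>2 1) - P = - mat 1"
    and tau_ex: "\<exists>t>0. matpow (closed_loop_matrix A B K C\<^sub>1 C\<^sub>2 L\<^sub>1 L\<^sub>2 0) t ** P
        ** transpose (matpow (closed_loop_matrix A B K C\<^sub>1 C\<^sub>2 L\<^sub>1 L\<^sub>2 0) t) - P \<preceq> - mat 1"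
    and tau_def: "\<tau> = (LEAST t. t > 0 \<and>
        matpow (closed_loop_matrix A B K C\<^sub>1 C\<^sub>2 L\<^sub>1 L\<^sub>2 0) t ** P
        ** transpose (matpow (closed_loop_matrix A B K C\<^sub>1 C\<^sub>2 L\<^sub>1 L\<^sub>2 0) t) - P \<preceq> - mat 1)"
    and switching: "\<And>\<omega>. \<omega> \<in> space M \<Longrightarrow>
        switching_rule \<tau> (threshold \<rho> S) (\<lambda>N. \<Phi>\<^sub>1 N \<omega>) (\<lambda>N. \<Phi>\<^sub>2 N \<omega>) (\<lambda>j. \<alpha> j \<omega>)"
    \<comment> \<open>attack hypothesis\<close>
    and attack: "\<exists>G>0. AE \<omega> in M. \<forall>N\<ge>1.
        (1 / real N) * (\<Sum>k<N. norm (residual_attack A C\<^sub>1 L\<^sub>1 v k \<omega>)) \<le> G / real N"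
  shows "limsup E \<in> sets M \<and> measure M (limsup E) = 0"
proof -
  interpret prob_space M by (rule prob)
  let ?G = "A + L\<^sub>1 ** C\<^sub>1" and ?Kb = "Kbar A C\<^sub>1 L\<^sub>1 Kw Kz"
  define e' where "e' n = e (int n - int k' - 1)" for n :: nat
  define r where "r n \<omega> = C\<^sub>1 *v free_error A C\<^sub>1 L\<^sub>1 w \<zeta> n \<omega> - \<zeta> n \<omega>" for n \<omega>
  define V where "V = residual_attack A C\<^sub>1 L\<^sub>1 v"
  have idx: "int n - int k' - 1 \<in> {- int k' - 1..}" for n :: nat by simp
  have ind_w: "indep_vars (\<lambda>_. borel) w UNIV" and ind_z: "indep_vars (\<lambda>_. borel) \<zeta> UNIV"
    using iid_w iid_zeta by (simp_all add: iid_zero_mean_def)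
  have ind_e: "indep_vars (\<lambda>_. borel) e' UNIV"
    unfolding e'_def using iid_e
    by (intro indep_vars_reindex[where X=e and I="{- int k' - 1..}"]) (auto simp: iid_zero_mean_def inj_def)
  have [measurable]: "w n \<in> borel_measurable M" "\<zeta> n \<in> borel_measurable M" "e' n \<in> borel_measurable M"
      "v n \<in> borel_measurable M" for n
    using ind_w ind_z ind_e meas_v by (simp_all add: indep_vars_def)
  have wz: "indep_random M (Pi\<^sub>M UNIV (\<lambda>_. borel)) (\<lambda>\<omega> n. w n \<omega>) (Pi\<^sub>M UNIV (\<lambda>_. borel)) (\<lambda>\<omega> n. \<zeta> n \<omega>)"
  proof -
    have "(\<lambda>y n. fst (y n)) \<in> Pi\<^sub>M UNIV (\<lambda>_. borel :: ((real^'m) \<times> (real^'m)) measure) \<rightarrow>\<^sub>M Pi\<^sub>M (UNIV :: nat set) (\<lambda>_. borel)"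
      unfolding borel_prod[symmetric] by (rule measurable_abs_UNIV) measurable
    from indep_random_compose[OF indep_w measurable_ident this] show ?thesis by simp
  qed
  have ewz: "indep_random M (Pi\<^sub>M UNIV (\<lambda>_. borel)) (\<lambda>\<omega> n. e' n \<omega>)
      (Pi\<^sub>M UNIV (\<lambda>_. borel \<Otimes>\<^sub>M borel)) (\<lambda>\<omega> n. (w n \<omega>, \<zeta> n \<omega>))"
  proof -
    have 1: "(\<lambda>x (n::nat). x (int n - int k' - 1)) \<in> Pi\<^sub>M {- int k' - 1..} (\<lambda>_. borel :: (real^'q) measure) \<rightarrow>\<^sub>M Pi\<^sub>M UNIV (\<lambda>_. borel)"
      by (rule measurable_abs_UNIV) (rule measurable_component_singleton, simp)
    have 2: "(\<lambda>y n. (fst (y n), fst (snd (y n))))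
        \<in> Pi\<^sub>M UNIV (\<lambda>_. borel :: ((real^'p) \<times> (real^'m) \<times> (real^'m)) measure)
          \<rightarrow>\<^sub>M Pi\<^sub>M (UNIV :: nat set) (\<lambda>_. borel \<Otimes>\<^sub>M borel)"
      unfolding borel_prod[symmetric] by (rule measurable_abs_UNIV) measurable
    from indep_random_compose[OF indep_e 1 2] show ?thesis by (simp add: e'_def)
  qed
  have zero: "expectation (w n) = 0" "expectation (\<zeta> n) = 0" "expectation (e' n) = 0" for n
    using iid_w iid_zeta iid_e idx by (simp_all add: iid_zero_mean_def e'_def)
  have bw: "AE \<omega> in M. norm (w n \<omega>) \<le> Kw" for n using bound_w by eventually_elim simp
  have bz: "AE \<omega> in M. norm (\<zeta> n \<omega>) \<le> Kz" for n using bound_z by eventually_elim simp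
  have be: "AE \<omega> in M. \<forall>n. norm (e' n \<omega>) \<le> Ke" using bound_e by eventually_elim (simp add: e'_def)
  then have be1: "AE \<omega> in M. norm (e' n \<omega>) \<le> Ke" for n by eventually_elim simp
  have nn: "0 \<le> Kw" "0 \<le> Kz" "0 \<le> Ke"
  proof -
    have *: "0 \<le> c" if "AE \<omega> in M. norm (X \<omega>) \<le> c" for c and X :: "'w \<Rightarrow> 'z::real_normed_vector"
    proof -
      from that have "AE \<omega> in M. 0 \<le> c" by eventually_elim (rule order_trans[OF norm_ge_zero])
      then show ?thesis by simp
    qed
    show "0 \<le> Kw" "0 \<le> Kz" "0 \<le> Ke" by (rule *[OF bw] *[OF bz] *[OF be1])+
  qed
  \<comment> \<open>a bound for \<open>Kbar\<close>, and hence for the entries of the residual without attack\<close>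
  define H where "H = 1 + S"
  have Kb: "?Kb n \<le> H" for n
    unfolding H_def
  proof (rule mono_bounded_if_c1_linear)
    have nn_term: "0 \<le> spectral_norm (noise_response ?G C\<^sub>1 l) * Kw
        + spectral_norm (measurement_response ?G C\<^sub>1 L\<^sub>1 l) * Kz" for l
      using nn by (simp add: spectral_norm_nonneg)
    show "0 \<le> ?Kb n" for n
      unfolding Kbar_eq_sum_responses by (intro sum_nonneg nn_term)
    show "mono ?Kb"
      unfolding Kbar_eq_sum_responses by (intro monoI sum_mono2 nn_term) auto
    show "c1 ?Kb N \<le> real N * S" if "N \<ge> 1" for N
      using S_bound[OF that] by simp
  qed
  obtain G where "0 < G" and G_ae: "AE \<omega> in M. \<forall>N\<ge>1.
        (1 / real N) * (\<Sum>k<N. norm (V k \<omega>)) \<le> G / real N"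
    using attack unfolding V_def by blast
  have d_eq: "d n \<omega> = r n \<omega> + V n \<omega>" if "\<omega> \<in> space M" for n \<omega>
  proof -
    have "d n \<omega> = C\<^sub>1 *v (xhat n \<omega> - x n \<omega>) - \<zeta> n \<omega> - v n \<omega>"
      by (simp add: residual[OF that] matrix_vector_mult_diff_distrib)
    also have "\<dots> = r n \<omega> + V n \<omega>"
      unfolding r_def V_def
      by (rule attacked_residual) (use observer2_init[OF that] observer2[OF that] in simp_all)
    finally show ?thesis .
  qed
  have dm: "d n \<in> borel_measurable M" for n
  proof -
    have "(\<lambda>\<omega>. r n \<omega> + V n \<omega>) \<in> borel_measurable M"
      unfolding r_def V_def free_error_def residual_attack_def by measurable
    then show ?thesis by (rule measurable_cong[THEN iffD2, rotated]) (rule d_eq)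
  qed
  note dm [measurable]
  have P1: "\<Phi>\<^sub>1 N \<omega> = (1 / real N) *\<^sub>R (\<Sum>n<N. outer_prod (d n \<omega>) (d n \<omega>) - R n)" for N \<omega>
    by (simp add: Phi1_def covariance_test_def)
  have P2: "\<Phi>\<^sub>2 N \<omega> = (1 / real N) *\<^sub>R (\<Sum>n<N. outer_prod (d n \<omega>) (e' n \<omega>))" for N \<omega>
    by (simp add: Phi2_def watermark_test_def e'_def)
  have E_meas: "E N \<in> events" for N
  proof -
    have [measurable]: "\<Phi>\<^sub>1 N \<in> borel_measurable M" unfolding P1[abs_def] by measurable
    have [measurable]: "\<Phi>\<^sub>2 N \<in> borel_measurable M" unfolding P2[abs_def] by measurable
    show ?thesis unfolding E_def detection_event_def by measurable
  qed
  define c\<^sub>1 where "c\<^sub>1 = sqrt ((1 + \<rho>) * S) / (2 * real CARD('m) * real CARD('m))"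
  define c\<^sub>2 where "c\<^sub>2 = sqrt ((1 + \<rho>) * S) / (2 * real CARD('m) * real CARD('q))"
  have c_pos: "0 < c\<^sub>1" "0 < c\<^sub>2" using S_pos rho_pos by (simp_all add: c\<^sub>1_def c\<^sub>2_def)
  note free = free_residual_tests_concentrate[OF ind_w ind_z ind_e wz ewz zero bw bz be1 nn Kb, folded r_def R_def]
  have cov: "AE \<omega> in M. \<forall>i j. \<forall>\<^sub>F N in sequentially.
      \<bar>\<Sum>n<N. r n \<omega> $ i * r n \<omega> $ j - R n $ i $ j\<bar> \<le> c\<^sub>1 * sqrt (real N * ln (real N))"
    unfolding AE_all_countable using free(1)[OF c_pos(1)] by blast
  have wat: "AE \<omega> in M. \<forall>i j. \<forall>\<^sub>F N in sequentially.
      \<bar>\<Sum>n<N. r n \<omega> $ i * e' n \<omega> $ j\<bar> \<le> c\<^sub>2 * sqrt (real N * ln (real N))"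
    unfolding AE_all_countable using free(2)[OF c_pos(2)] by blast
  have rbd: "AE \<omega> in M. \<forall>n i. \<bar>r n \<omega> $ i\<bar> \<le> H"
    unfolding AE_all_countable using free(3)[OF c_pos(1)] by blast
  have "AE \<omega> in M. \<omega> \<notin> limsup E"
    using AE_space G_ae cov wat rbd be
  proof eventually_elim
    case (elim \<omega>)
    note d = d_eq[OF elim(1)]
    have V_sum: "(\<Sum>k<N. norm (V k \<omega>)) \<le> G" for N
    proof (cases "N \<ge> 1")
      case True
      then show ?thesis using elim(2) by (force simp: divide_le_cancel)
    qed (use \<open>0 < G\<close> in \<open>simp add: not_le\<close>)
    have V_le: "norm (V n \<omega>) \<le> G" for n
      using V_sum[of "Suc n"] sum_nonneg[of "{..<n}" "\<lambda>k. norm (V k \<omega>)"] by simp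
    have V_comp: "\<bar>V n \<omega> $ i\<bar> \<le> norm (V n \<omega>)" for n i by (rule component_le_norm_cart)
    have "\<forall>\<^sub>F N in sequentially. spectral_norm (\<Phi>\<^sub>1 N \<omega>) \<le> threshold \<rho> S N"
      unfolding P1
    proof (rule eventually_spectral_norm_le_threshold[OF S_pos rho_pos c\<^sub>1_def])
      fix i j
      show "\<forall>\<^sub>F N in sequentially. \<bar>(\<Sum>n<N. outer_prod (d n \<omega>) (d n \<omega>) - R n) $ i $ j\<bar>
          \<le> c\<^sub>1 * sqrt (real N * ln (real N)) + (2 * H + G) * G"
        using elim(3)[rule_format, of i j]
      proof eventually_elim
        case (elim N)
        \<comment> \<open>Every term that the attack adds contains a factor \<open>V n\<close>, and the other factor is at most
            \<open>H\<close> or \<open>G\<close>; so these terms are absolutely summable.\<close>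
        have "\<bar>r n \<omega> $ i * V n \<omega> $ j + V n \<omega> $ i * r n \<omega> $ j + V n \<omega> $ i * V n \<omega> $ j\<bar>
            \<le> (2 * H + G) * norm (V n \<omega>)" for n
        proof -
          have "\<bar>r n \<omega> $ i\<bar> * \<bar>V n \<omega> $ j\<bar> \<le> H * norm (V n \<omega>)"
            "\<bar>V n \<omega> $ i\<bar> * \<bar>r n \<omega> $ j\<bar> \<le> norm (V n \<omega>) * H"
            "\<bar>V n \<omega> $ i\<bar> * \<bar>V n \<omega> $ j\<bar> \<le> G * norm (V n \<omega>)"
            using \<open>\<forall>n i. \<bar>r n \<omega> $ i\<bar> \<le> H\<close> V_comp order_trans[OF V_comp V_le] \<open>0 < G\<close>
            by (auto intro!: mult_mono' simp del: abs_mult)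
          then show ?thesis unfolding abs_mult[symmetric] by (simp add: algebra_simps)
        qed
        then have "\<bar>\<Sum>n<N. r n \<omega> $ i * V n \<omega> $ j + V n \<omega> $ i * r n \<omega> $ j + V n \<omega> $ i * V n \<omega> $ j\<bar>
            \<le> (\<Sum>n<N. (2 * H + G) * norm (V n \<omega>))"
          by (intro order_trans[OF sum_abs] sum_mono)
        also have "\<dots> \<le> (2 * H + G) * G"
          unfolding sum_distrib_left[symmetric] using V_sum S_pos \<open>0 < G\<close> by (intro mult_left_mono) (auto simp: H_def)
        finally have "\<bar>\<Sum>n<N. r n \<omega> $ i * V n \<omega> $ j + V n \<omega> $ i * r n \<omega> $ j + V n \<omega> $ i * V n \<omega> $ j\<bar>
            \<le> (2 * H + G) * G" .
        moreover have "(\<Sum>n<N. outer_prod (d n \<omega>) (d n \<omega>) - R n) $ i $ j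
            = (\<Sum>n<N. r n \<omega> $ i * r n \<omega> $ j - R n $ i $ j)
              + (\<Sum>n<N. r n \<omega> $ i * V n \<omega> $ j + V n \<omega> $ i * r n \<omega> $ j + V n \<omega> $ i * V n \<omega> $ j)"
          unfolding sum.distrib[symmetric] by (simp add: sum_component outer_prod_def d algebra_simps)
        ultimately show ?case using elim by linarith
      qed
    qed
    moreover have "\<forall>\<^sub>F N in sequentially. spectral_norm (\<Phi>\<^sub>2 N \<omega>) \<le> threshold \<rho> S N"
      unfolding P2
    proof (rule eventually_spectral_norm_le_threshold[OF S_pos rho_pos c\<^sub>2_def])
      fix i j
      have e_comp: "\<bar>e' n \<omega> $ j\<bar> \<le> Ke" for n
        using order_trans[OF component_le_norm_cart elim(6)[rule_format]] .
      show "\<forall>\<^sub>F N in sequentially. \<bar>(\<Sum>n<N. outer_prod (d n \<omega>) (e' n \<omega>)) $ i $ j\<bar>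
          \<le> c\<^sub>2 * sqrt (real N * ln (real N)) + G * Ke"
        using elim(4)[rule_format, of i j]
      proof eventually_elim
        case (elim N)
        have "\<bar>\<Sum>n<N. V n \<omega> $ i * e' n \<omega> $ j\<bar> \<le> (\<Sum>n<N. norm (V n \<omega>) * Ke)"
          using V_comp e_comp by (intro order_trans[OF sum_abs] sum_mono) (simp add: abs_mult mult_mono')
        also have "\<dots> \<le> G * Ke"
          unfolding sum_distrib_right[symmetric] using V_sum nn(3) by (intro mult_right_mono) auto
        finally have "\<bar>\<Sum>n<N. V n \<omega> $ i * e' n \<omega> $ j\<bar> \<le> G * Ke" .
        moreover have "(\<Sum>n<N. outer_prod (d n \<omega>) (e' n \<omega>)) $ i $ j
            = (\<Sum>n<N. r n \<omega> $ i * e' n \<omega> $ j) + (\<Sum>n<N. V n \<omega> $ i * e' n \<omega> $ j)"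
          unfolding sum.distrib[symmetric] by (simp add: sum_component outer_prod_def d algebra_simps)
        ultimately show ?case using elim by linarith
      qed
    qed
    ultimately have "\<forall>\<^sub>F N in sequentially. \<omega> \<notin> E N"
      by eventually_elim (auto simp: E_def detection_event_def)
    then show ?case by (simp add: mem_limsup_iff not_frequently)
  qed
  moreover have "limsup E \<in> events" using E_meas by (intro measurable_limsup) auto
  ultimately show ?thesis by (auto dest!: AE_iff_measurable[THEN iffD1, rotated 2] simp: prob_eq_0)
qed

end
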